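(* Let $m\in\mathbb{N}$ and $0<x<2\pi$. Then $$\sum_{k=1}^\infty\frac{\zeta(2k)}{(2k)_{2m-1}}\left(\frac{x}{2\pi}\right)^{2k}=\frac{\log x-H_{2m-2}}{2(2m-2)!}+\frac{\left(\frac{2\pi}{x}\right)^{2m-2}}{2(2m-2)!}\left(\zeta'\left(2-2m,1-\frac{x}{2\pi}\right)+\zeta'\left(2-2m,\frac{x}{2\pi}\right)\right)+(-1)^m\sum_{k=0}^{m-2}\frac{(-1)^k x^{2k-2m+2}\,\zeta(2m-2k-1)}{2(2k)!}.$$
   Context: $\mathbb{N}=\{1,2,3,\dots\}$. $\zeta(s)$ is the Riemann zeta function; $\zeta(s,a)$, for $0<a\leqslant 1$, is the Hurwitz zeta function (analytic continuation in $s$ of $\sum_{n=0}^\infty(n+a)^{-s}$), and $\zeta'(s,a)=\frac{\partial}{\partial s}\zeta(s,a)$ is its derivative with respect to the first argument. $(z)_r=z(z+1)\cdots(z+r-1)$ is the Pochhammer symbol (rising factorial). $H_r=\sum_{j=1}^r \frac1j$ is the harmonic number, with $H_0=0$. The finite sum over $k$ from $0$ to $m-2$ is empty (equal to $0$) when $m=1$. *)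

theory Defs
  imports "HOL-Complex_Analysis.Complex_Analysis"
begin

definition is_hurwitz_continuation :: "real \<Rightarrow> (complex \<Rightarrow> complex) \<Rightarrow> bool" where
  "is_hurwitz_continuation a f \<longleftrightarrow>
     f holomorphic_on (- {1}) \<and>
     (\<forall>s. Re s > 1 \<longrightarrow> (\<lambda>n. complex_of_real (real n + a) powr (- s)) sums f s)"

lemma is_hurwitz_continuation_unique:
  assumes "is_hurwitz_continuation a f" "is_hurwitz_continuation a g" "s \<noteq> 1"
  shows "f s = g s"
proof -
  have "f s - g s = 0"
  proof (rule analytic_continuation[where f = "\<lambda>s. f s - g s" and S = "- {1}"
          and U = "{s. Re s > 1}" and \<xi> = 2])
    show "(\<lambda>s. f s - g s) holomorphic_on (- {1})"
      using assms by (auto simp: is_hurwitz_continuation_def intro!: holomorphic_intros)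
    show "open (- {1 :: complex})" by auto
    show "connected (- {1 :: complex})"
      by (rule connected_punctured_universe) simp
    show "{s. Re s > 1} \<subseteq> - {1 :: complex}" by auto
    show "2 islimpt {s. Re s > 1}"
      by (intro interior_limit_point)
         (auto simp: interior_open open_halfspace_Re_gt)
    show "f z - g z = 0" if "z \<in> {s. Re s > 1}" for z
      using that assms sums_unique2 by (fastforce simp: is_hurwitz_continuation_def)
  qed (use assms in auto)
  thus ?thesis by simp
qed

text \<open>
  For \<open>a > 0\<close> the continuation exists, and by the lemma above it is unique away from
  the pole \<open>s = 1\<close>, where the choice below leaves the value unspecified.
\<close>
definition hurwitz_zeta :: "complex \<Rightarrow> real \<Rightarrow> complex" where
  "hurwitz_zeta s a = (SOME f. is_hurwitz_continuation a f) s"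

definition riemann_zeta :: "complex \<Rightarrow> complex" where
  "riemann_zeta s = hurwitz_zeta s 1"

definition hurwitz_zeta' :: "complex \<Rightarrow> real \<Rightarrow> complex" where
  "hurwitz_zeta' s a = deriv (\<lambda>z. hurwitz_zeta z a) s"

end

theory Submission
  imports Defs
begin

text \<open>
Put \<open>y = x / (2 * pi)\<close> and \<open>N = 2 * m - 2\<close>, so that \<open>0 < y < 1\<close> and \<open>N\<close> is even.  Expanding each
\<open>(n \<plusminus> y) powr (-s)\<close>, \<open>n \<ge> 1\<close>, by the binomial series and summing over \<open>n\<close> gives
\[ \zeta(s,y) + \zeta(s,1-y) = y^{-s} + 2 \sum_{i \ge 0} \frac{(s)_{2i}}{(2i)!} \zeta(s+2i) y^{2i}, \]
because the odd powers of \<open>y\<close> cancel.  This holds for \<open>Re s > 1\<close>, and then for all \<open>s \<noteq> 1\<close> by analytic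
continuation, with the removable singularities at \<open>s + 2 * i = 1\<close> filled in.  The theorem is the
derivative of this identity at \<open>s = -N\<close>; the derivative of the series is
\<open>hurwitz_zeta'_symmetric_sums\<close>.  The terms fall into three groups.

  \<^item> If \<open>2 * i > N\<close>, then \<open>(s)_{2i}\<close> has a simple zero at \<open>-N\<close>, and only its derivative survives.  It
    turns the term into a summand of the series in the theorem, with \<open>2 * k = 2 * i - N\<close>.

  \<^item> If \<open>2 * i = N\<close>, then the derivative of the Pochhammer symbol contributes the harmonic number, and
    the values \<open>\<zeta>(0) = -1/2\<close> and \<open>\<zeta>'(0) = -ln (2 * pi) / 2\<close> enter; together with the derivative of
    \<open>y powr (-s)\<close> this produces \<open>ln x - harm N\<close>.

  \<^item> If \<open>2 * i < N\<close>, then \<open>\<zeta>(-2n) = 0\<close> for \<open>2 * n = N - 2 * i\<close>, and the derivative of the term is a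
    multiple of \<open>\<zeta>'(-2n)\<close>, which the functional equation expresses by \<open>\<zeta>(2n+1)\<close>.

So three things are needed: the continuation, the functional equation, and the two values at \<open>0\<close>.

The continuation comes from the same binomial expansion, applied with shift \<open>1\<close> to the sums
\<open>\<Sum>n. (n+2) powr (-s)\<close>.  There it telescopes and expresses \<open>(s - 1) * (\<zeta>(s) - 1)\<close> by the values at
\<open>s + 1, s + 2, \<dots>\<close> (\<open>unit_shift_recursion\<close>), so that the domain grows by one strip at a time.
Working with the entire function \<open>(s - 1) * \<zeta>(s)\<close> avoids all poles: in \<open>(s)_j * \<zeta>(s + j)\<close> the
factor \<open>s + j - 1\<close> of the Pochhammer symbol cancels the pole of zeta.

For the functional equation let \<open>-1 < s < 0\<close> be real.  The trapezoid rule gives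
\<open>\<zeta>(s) = s * (s + 1) * (\<Sum>n. \<integral>\<^sub>0\<^sup>1 v * (1 - v) / 2 * (n + v) powr (-s-2) dv)\<close>.  All integrands are
nonnegative, so one may write \<open>\<Gamma>(s+2) * u powr (-s-2)\<close> as a Laplace integral and interchange freely.
The sum over \<open>n\<close> becomes a geometric series and leads to \<open>coth (t/2) / 2 - 1/t\<close>; its
partial fractions \<open>\<Sum>n. 2 * t / (t\<^sup>2 + (2 * pi * (n+1))\<^sup>2)\<close>, integrated term by term, give
\<open>\<zeta>(1 - s)\<close>.  The partial fractions follow from the logarithmic derivative of the reflection formula
of the Gamma function.  The value \<open>\<zeta>'(0)\<close> needs the second coefficient of zeta at \<open>1\<close>, Euler's
constant, which the same trapezoid series yields at \<open>s = 1\<close>.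
\<close>

section \<open>Hurwitz series in the half plane of convergence\<close>

definition dirichlet_sum :: "real \<Rightarrow> complex \<Rightarrow> complex" where
  "dirichlet_sum b s = (\<Sum>n. complex_of_real (real n + b) powr (- s))"

lemma norm_of_real_powr:
  assumes "u > 0"
  shows "norm (complex_of_real u powr s) = u powr Re s"
proof -
  have "norm (complex_of_real u powr s) = Re (complex_of_real u) powr Re s"
    by (rule norm_powr_real_powr) (use assms in auto)
  thus ?thesis by simp
qed

lemma norm_shifted_powr_le:
  assumes "b \<ge> 1" "\<sigma> \<le> Re s"
  shows "norm (complex_of_real (real n + b) powr (- s)) \<le> (real n + b) powr (-\<sigma>)"
proof -
  have "norm (complex_of_real (real n + b) powr (- s)) = (real n + b) powr (- Re s)"
    using assms(1) by (subst norm_of_real_powr) auto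
  also have "\<dots> \<le> (real n + b) powr (-\<sigma>)"
    by (rule powr_mono) (use assms in auto)
  finally show ?thesis .
qed

lemma summable_shifted_powr:
  assumes "b \<ge> 1" "\<sigma> > 1"
  shows "summable (\<lambda>n. (real n + b) powr (-\<sigma>))"
proof (rule summable_comparison_test')
  show "summable (\<lambda>n. real (Suc n) powr (-\<sigma>))"
    using assms by (subst summable_Suc_iff) (simp add: summable_real_powr_iff)
  show "norm ((real n + b) powr (-\<sigma>)) \<le> real (Suc n) powr (-\<sigma>)" if "n \<ge> 0" for n
    using assms by (auto intro!: powr_mono2')
qed

lemma summable_norm_dirichlet:
  assumes "b \<ge> 1" "Re s > 1"
  shows "summable (\<lambda>n. norm (complex_of_real (real n + b) powr (- s)))"
proof (rule summable_comparison_test'[OF summable_shifted_powr[OF assms]])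
  show "norm (norm (complex_of_real (real n + b) powr (- s))) \<le> (real n + b) powr (- Re s)" for n
    using norm_shifted_powr_le[OF assms(1) order.refl, of n s] by (simp del: of_real_add)
qed

lemma dirichlet_sums:
  assumes "b \<ge> 1" "Re s > 1"
  shows "(\<lambda>n. complex_of_real (real n + b) powr (- s)) sums dirichlet_sum b s"
  unfolding dirichlet_sum_def
  by (rule summable_sums, rule summable_norm_cancel, rule summable_norm_dirichlet) (use assms in auto)

lemma norm_dirichlet_sum_le:
  assumes "b \<ge> 1" "1 < \<sigma>" "\<sigma> \<le> Re s"
  shows "norm (dirichlet_sum b s) \<le> (\<Sum>n. (real n + b) powr (-\<sigma>))"
proof -
  have "norm (dirichlet_sum b s) \<le> (\<Sum>n. norm (complex_of_real (real n + b) powr (- s)))"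
    unfolding dirichlet_sum_def by (intro summable_norm summable_norm_dirichlet) (use assms in auto)
  also have "\<dots> \<le> (\<Sum>n. (real n + b) powr (-\<sigma>))"
    by (intro suminf_le norm_shifted_powr_le summable_norm_dirichlet summable_shifted_powr)
       (use assms in auto)
  finally show ?thesis .
qed

lemma holomorphic_dirichlet_sum:
  assumes "b \<ge> 1"
  shows "dirichlet_sum b holomorphic_on {s. Re s > 1}"
proof -
  let ?f = "\<lambda>n s. complex_of_real (real n + b) powr (- s)"
  have op: "open {s. Re s > 1}" by (rule open_halfspace_Re_gt)
  have "\<exists>d h. 0 < d \<and> summable h \<and>
          (\<forall>\<^sub>F n in sequentially. \<forall>y\<in>ball x d \<inter> {s. Re s > 1}. norm (?f n y) \<le> h n)"
    if x: "x \<in> {s. Re s > 1}" for x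
  proof (intro exI conjI always_eventually allI ballI)
    define d where "d = (Re x - 1) / 2"
    show "d > 0" using x by (simp add: d_def)
    show "summable (\<lambda>n. (real n + b) powr (-(1 + d)))"
      using \<open>d > 0\<close> assms by (intro summable_shifted_powr) auto
    fix n y assume "y \<in> ball x d \<inter> {s. Re s > 1}"
    hence "norm (x - y) < d" by (auto simp: dist_norm)
    hence "1 + d \<le> Re y"
      using abs_Re_le_cmod[of "x - y"] by (simp add: d_def field_simps)
    thus "norm (?f n y) \<le> (real n + b) powr (-(1 + d))"
      using assms by (intro norm_shifted_powr_le)
  qed
  moreover have "(?f n has_field_derivative deriv (?f n) s) (at s)" for n s
  proof -
    have "?f n field_differentiable at s"
      by (rule holomorphic_on_imp_differentiable_at[of _ UNIV]) (auto intro!: holomorphic_intros)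
    thus ?thesis using field_differentiable_derivI by blast
  qed
  ultimately obtain g g' where g: "\<forall>s\<in>{s. Re s > 1}. (\<lambda>n. ?f n s) sums g s \<and>
      (\<lambda>n. deriv (?f n) s) sums g' s \<and> (g has_field_derivative g' s) (at s)"
    using series_and_derivative_comparison_local[OF op, of ?f "\<lambda>n. deriv (?f n)"] by auto
  have "g holomorphic_on {s. Re s > 1}"
    using g op by (auto simp: holomorphic_on_open)
  also have "?this \<longleftrightarrow> ?thesis"
  proof (rule holomorphic_cong)
    show "g s = dirichlet_sum b s" if "s \<in> {s. Re s > 1}" for s
    proof (rule sums_unique2)
      show "(\<lambda>n. ?f n s) sums g s" using g that by blast
      show "(\<lambda>n. ?f n s) sums dirichlet_sum b s" using dirichlet_sums[OF assms] that by blast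
    qed
  qed auto
  finally show ?thesis .
qed

lemma summable_pochhammer_power:
  fixes R r :: real
  assumes "0 \<le> r" "r < 1"
  shows "summable (\<lambda>j. pochhammer R j / fact j * r ^ j)"
proof -
  have "(\<lambda>j. ((-R) gchoose j) * (-r) ^ j) sums (1 + (-r)) powr (-R)"
    by (rule gen_binomial_real) (use assms in auto)
  also have "(\<lambda>j. ((-R) gchoose j) * (-r) ^ j) = (\<lambda>j. pochhammer R j / fact j * r ^ j)"
  proof
    fix j
    have "(-1) ^ j * (-r) ^ j = r ^ j" by (simp flip: power_mult_distrib)
    thus "((-R) gchoose j) * (-r) ^ j = pochhammer R j / fact j * r ^ j"
      by (simp add: gbinomial_pochhammer field_simps)
  qed
  finally show ?thesis by (rule sums_summable)
qed

lemma norm_pochhammer_le: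
  fixes s :: complex
  assumes "norm s \<le> R"
  shows "norm (pochhammer s j) \<le> pochhammer R j"
proof (induction j)
  case (Suc j)
  have "norm (s + of_nat j) \<le> R + of_nat j"
    by (rule order.trans[OF norm_triangle_ineq]) (use assms in simp)
  moreover have "0 \<le> pochhammer R j" using Suc norm_ge_zero order.trans by blast
  ultimately show ?case using Suc unfolding pochhammer_Suc norm_mult
    by (intro mult_mono) auto
qed auto

text \<open>
The summand is \<open>(n + b) powr (-s)\<close> times a binomial series in \<open>y / (n + b)\<close>.  The two summations may be
interchanged since the double series is dominated by a product \<open>u n * v j\<close>: among arguments of a given
norm the Pochhammer symbol is largest at the positive real one, and \<open>n + b \<ge> b\<close>.
\<close>
lemma dirichlet_sum_expansion:
  fixes y :: real
  assumes b: "b \<ge> 1" and y: "\<bar>y\<bar> < b" and s: "Re s > 1"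
  obtains S where
    "(\<lambda>n. complex_of_real (real n + b - y) powr (- s)) sums S"
    "(\<lambda>j. pochhammer s j / fact j * dirichlet_sum b (s + of_nat j) * of_real y ^ j) sums S"
proof -
  define f where "f = (\<lambda>(n, j). pochhammer s j / fact j *
     (complex_of_real (real n + b) powr (- (s + of_nat j)) * of_real y ^ j))"
  define u where "u = (\<lambda>n. (real n + b) powr (- Re s))"
  define v where "v = (\<lambda>j. pochhammer (norm s) j / fact j * (\<bar>y\<bar> / b) ^ j)"
  have ns: "norm s > 0" using s by auto
  have nonneg: "u n \<ge> 0" "v n \<ge> 0" for n
    using b ns by (auto simp: u_def v_def pochhammer_nonneg)
  have "summable u" unfolding u_def by (rule summable_shifted_powr[OF b s])
  hence u: "u summable_on UNIV" using nonneg by (intro norm_summable_imp_summable_on) simp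
  have "summable v" unfolding v_def
    by (rule summable_pochhammer_power) (use b y in auto)
  hence v: "v summable_on UNIV" using nonneg by (intro norm_summable_imp_summable_on) simp
  have le: "norm (f (n, j)) \<le> u n * v j" for n j
  proof -
    have "norm (complex_of_real (real n + b) powr (- (s + of_nat j)))
        = (real n + b) powr (- Re s - real j)"
      using b by (subst norm_of_real_powr) auto
    also have "\<dots> = u n / (real n + b) ^ j"
      using b unfolding u_def powr_diff by (subst powr_realpow) auto
    also have "\<dots> \<le> u n / b ^ j"
      using b by (intro divide_left_mono power_mono) (auto simp: u_def)
    finally have "norm (f (n, j)) \<le> pochhammer (norm s) j / fact j * (u n / b ^ j * \<bar>y\<bar> ^ j)"
      unfolding f_def prod.case norm_mult norm_divide norm_power norm_fact norm_of_real
      by (intro mult_mono divide_right_mono norm_pochhammer_le) (use ns nonneg b in \<open>auto simp: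
          pochhammer_nonneg intro!: mult_nonneg_nonneg divide_nonneg_nonneg\<close>)
    also have "\<dots> = u n * v j" by (simp add: v_def power_divide)
    finally show ?thesis by simp
  qed
  have uv: "(\<lambda>(n, j). u n * v j) summable_on UNIV \<times> UNIV"
  proof (rule summable_on_SigmaI)
    show "((\<lambda>j. case (n, j) of (n, j) \<Rightarrow> u n * v j) has_sum (u n * infsum v UNIV)) UNIV" for n
      using v by (simp add: has_sum_cmult_right)
    show "(\<lambda>n. u n * infsum v UNIV) summable_on UNIV"
      using u by (rule summable_on_cmult_left)
  qed (use nonneg in auto)
  have f: "f summable_on UNIV \<times> UNIV"
    by (rule abs_summable_summable, rule summable_on_comparison_test[OF uv]) (use le in auto)
  define S where "S = infsum f (UNIV \<times> UNIV)"
  have S: "(f has_sum S) (UNIV \<times> UNIV)" using f by (simp add: S_def)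
  have sj: "(\<lambda>j. f (n, j)) summable_on UNIV" for n
    using summable_on_SigmaD1[of "\<lambda>x y. f (x, y)" UNIV "\<lambda>_. UNIV" n] f by (simp add: case_prod_unfold)
  have S': "((\<lambda>(j, n). f (n, j)) has_sum S) (UNIV \<times> UNIV)"
    using S by (subst (asm) has_sum_swap) (simp add: case_prod_unfold)
  have sn: "(\<lambda>n. f (n, j)) summable_on UNIV" for j
    using summable_on_SigmaD1[of "\<lambda>x y. f (y, x)" UNIV "\<lambda>_. UNIV" j] S'
    by (auto simp: case_prod_unfold summable_on_def)
  have 1: "((\<lambda>j. f (n, j)) has_sum (complex_of_real (real n + b - y) powr (- s))) UNIV" for n
  proof -
    let ?z = "complex_of_real (- y / (real n + b))"
    have "norm ?z < 1" using b y unfolding norm_of_real by (simp add: divide_simps abs_of_pos)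
    hence "(\<lambda>j. ((-s) gchoose j) * ?z ^ j) sums (1 + ?z) powr (-s)"
      by (rule gen_binomial_complex)
    hence "(\<lambda>j. complex_of_real (real n + b) powr (-s) * (((-s) gchoose j) * ?z ^ j)) sums
             (complex_of_real (real n + b) powr (-s) * (1 + ?z) powr (-s))"
      by (rule sums_mult)
    also have "(\<lambda>j. complex_of_real (real n + b) powr (-s) * (((-s) gchoose j) * ?z ^ j))
        = (\<lambda>j. f (n, j))"
    proof
      fix j
      have "complex_of_real (real n + b) powr (- (s + of_nat j)) =
              complex_of_real (real n + b) powr (- s) / complex_of_real (real n + b) ^ j"
        using b by (simp add: powr_diff powr_nat del: of_real_add)
      moreover have "(-1) ^ j * ?z ^ j = of_real y ^ j / complex_of_real (real n + b) ^ j"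
        by (simp add: power_divide del: of_real_add flip: power_mult_distrib)
      ultimately show "complex_of_real (real n + b) powr (-s) * (((-s) gchoose j) * ?z ^ j) = f (n, j)"
        by (simp add: f_def gbinomial_pochhammer mult_ac del: of_real_add)
    qed
    also have "complex_of_real (real n + b) powr (-s) * (1 + ?z) powr (-s) =
                 (complex_of_real (real n + b) * (1 + ?z)) powr (-s)"
    proof -
      have "1 + ?z = complex_of_real (1 - y / (real n + b))" by simp
      moreover have "1 - y / (real n + b) \<ge> 0" using b y by (simp add: divide_simps)
      ultimately show ?thesis using b powr_times_real[of "complex_of_real (real n + b)" "1 + ?z"]
        by (smt (verit) Re_complex_of_real Reals_of_real of_nat_0_le_iff)
    qed
    also have "complex_of_real (real n + b) * (1 + ?z) = of_real (real n + b - y)"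
    proof -
      have "(real n + b) * (1 + - y / (real n + b)) = real n + b - y"
        using b by (simp add: field_simps)
      thus ?thesis by (metis of_real_1 of_real_add of_real_mult)
    qed
    finally have "(\<lambda>j. f (n, j)) sums (complex_of_real (real n + b - y) powr (- s))" .
    moreover have "(\<lambda>j. f (n, j)) sums infsum (\<lambda>j. f (n, j)) UNIV"
      using sj by (intro has_sum_imp_sums has_sum_infsum)
    ultimately have "complex_of_real (real n + b - y) powr (- s) = infsum (\<lambda>j. f (n, j)) UNIV"
      by (rule sums_unique2)
    thus ?thesis using has_sum_infsum[OF sj[of n]] by (simp only:)
  qed
  have 2: "((\<lambda>n. f (n, j)) has_sum (pochhammer s j / fact j * dirichlet_sum b (s + of_nat j)
      * of_real y ^ j)) UNIV" for j
  proof -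
    have "(\<lambda>n. complex_of_real (real n + b) powr (- (s + of_nat j))) sums dirichlet_sum b (s + of_nat j)"
      using s b by (intro dirichlet_sums) auto
    from sums_mult[OF sums_mult2[OF this, of "of_real y ^ j"], of "pochhammer s j / fact j"]
    have "(\<lambda>n. f (n, j)) sums (pochhammer s j / fact j * dirichlet_sum b (s + of_nat j) * of_real y ^ j)"
      by (simp add: f_def mult_ac)
    moreover have "(\<lambda>n. f (n, j)) sums infsum (\<lambda>n. f (n, j)) UNIV"
      using sn by (intro has_sum_imp_sums has_sum_infsum)
    ultimately have "pochhammer s j / fact j * dirichlet_sum b (s + of_nat j) * of_real y ^ j =
        infsum (\<lambda>n. f (n, j)) UNIV" by (rule sums_unique2)
    thus ?thesis using has_sum_infsum[OF sn[of j]] by (simp only:)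
  qed
  show ?thesis
  proof (rule that)
    show "(\<lambda>n. complex_of_real (real n + b - y) powr (- s)) sums S"
      by (rule has_sum_imp_sums, rule has_sum_SigmaD[OF S]) (use 1 in auto)
    show "(\<lambda>j. pochhammer s j / fact j * dirichlet_sum b (s + of_nat j) * of_real y ^ j) sums S"
      by (rule has_sum_imp_sums, rule has_sum_SigmaD[OF S']) (use 2 in auto)
  qed
qed

section \<open>Shift series and the entire continuation\<close>

text \<open>
The geometric decay of the sums as \<open>Re s\<close> grows.  It makes the expansion in powers of \<open>y\<close> converge for
every \<open>s\<close>, also far to the left of the half plane where the original series converges.
\<close>
lemma norm_dirichlet_sum_le_power:
  assumes "b \<ge> 1" "2 + real k \<le> Re s"
  shows "norm (dirichlet_sum b s) \<le> (\<Sum>n. (real n + b) powr (-2)) / b ^ k"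
proof -
  have "norm (dirichlet_sum b s) \<le> (\<Sum>n. (real n + b) powr (-(2 + real k)))"
    by (rule norm_dirichlet_sum_le) (use assms in auto)
  also have "\<dots> \<le> (\<Sum>n. (real n + b) powr (-2) / b ^ k)"
  proof (rule suminf_le)
    fix n
    have "(real n + b) powr (-(2 + real k)) = (real n + b) powr (-2) / (real n + b) ^ k"
      using assms powr_diff[of "real n + b" "-2" "real k"] powr_realpow[of "real n + b" k] by simp
    also have "\<dots> \<le> (real n + b) powr (-2) / b ^ k"
      using assms by (intro divide_left_mono power_mono) auto
    finally show "(real n + b) powr (-(2 + real k)) \<le> (real n + b) powr (-2) / b ^ k" .
    show "summable (\<lambda>n. (real n + b) powr (-(2 + real k)))"
      by (rule summable_shifted_powr) (use assms in auto)
    show "summable (\<lambda>n. (real n + b) powr (-2) / b ^ k)"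
      by (rule summable_divide, rule summable_shifted_powr) (use assms in auto)
  qed
  also have "\<dots> = (\<Sum>n. (real n + b) powr (-2)) / b ^ k"
    by (rule suminf_divide, rule summable_shifted_powr) (use assms in auto)
  finally show ?thesis .
qed

text \<open>
For \<open>h s = (s - 1) * \<zeta>(s)\<close> this is the term \<open>(s)_j / j! * \<zeta>(s + j) * y ^ j\<close> of the expansion, with the
last factor \<open>s + j - 1\<close> of the Pochhammer symbol moved into \<open>h\<close>; so it has no pole.
\<close>
definition shift_term :: "(complex \<Rightarrow> complex) \<Rightarrow> real \<Rightarrow> nat \<Rightarrow> complex \<Rightarrow> complex" where
  "shift_term h y j s = pochhammer s (j - 1) / fact j * h (s + of_nat j) * of_real y ^ j"

lemma shift_term_eq:
  assumes "\<And>s. Re s > 1 \<Longrightarrow> h s = (s - 1) * dirichlet_sum b s" "j \<ge> 1" "Re s + real j > 1"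
  shows "shift_term h y j s = pochhammer s j / fact j * dirichlet_sum b (s + of_nat j) * of_real y ^ j"
proof -
  obtain i where j: "j = Suc i" using assms(2) by (cases j) auto
  have "h (s + of_nat j) = (s + of_nat i) * dirichlet_sum b (s + of_nat j)"
    using assms(1)[of "s + of_nat j"] assms(3) by (simp add: j)
  thus ?thesis unfolding shift_term_def by (simp add: j pochhammer_Suc)
qed

lemma holomorphic_on_pochhammer [holomorphic_intros]:
  "f holomorphic_on A \<Longrightarrow> (\<lambda>s. pochhammer (f s) n) holomorphic_on A"
  by (induction n) (auto simp: pochhammer_Suc intro!: holomorphic_intros)

text \<open>
Near a given \<open>s\<close>, all but finitely many of the arguments \<open>s + j\<close> lie in the half plane of convergence.
There the terms are those of \<open>dirichlet_sum_expansion\<close> and decay like \<open>(\<bar>y\<bar> / b) ^ j\<close>, up to a factor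
growing polynomially.  Hence the series converges locally uniformly wherever its terms are
defined, and may be differentiated term by term.
\<close>
lemma shift_series:
  fixes h :: "complex \<Rightarrow> complex"
  assumes b: "b \<ge> 1" "\<bar>y\<bar> < b" and J: "J \<ge> 1"
    and U: "open U" and V: "open V" and UV: "\<And>s j. s \<in> U \<Longrightarrow> j \<ge> J \<Longrightarrow> s + of_nat j \<in> V"
    and h: "h holomorphic_on V" "\<And>s. Re s > 1 \<Longrightarrow> h s = (s - 1) * dirichlet_sum b s"
  obtains g where "\<And>s. s \<in> U \<Longrightarrow> (\<lambda>i. shift_term h y (i + J) s) sums g s"
    "\<And>s. s \<in> U \<Longrightarrow> (\<lambda>i. deriv (shift_term h y (i + J)) s) sums deriv g s"
    "g holomorphic_on U"
proof -
  define C where "C = (\<Sum>n. (real n + b) powr (-2))"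
  have C: "C \<ge> 0" unfolding C_def by (intro suminf_nonneg summable_shifted_powr) (use b in auto)
  have diff: "(shift_term h y (i + J) has_field_derivative deriv (shift_term h y (i + J)) s) (at s)"
    if "s \<in> U" for s i
  proof -
    have "(\<lambda>s. s + of_nat (i + J)) ` U \<subseteq> V" using UV by (auto simp del: of_nat_add)
    hence "(h \<circ> (\<lambda>s. s + of_nat (i + J))) holomorphic_on U"
      by (intro holomorphic_on_compose_gen[OF _ h(1)] holomorphic_intros)
    hence "shift_term h y (i + J) holomorphic_on U"
      unfolding shift_term_def o_def by (intro holomorphic_intros) auto
    hence "shift_term h y (i + J) field_differentiable at s"
      using U that by (rule holomorphic_on_imp_differentiable_at)
    thus ?thesis using field_differentiable_derivI by blast
  qed
  have bound: "\<exists>d H. 0 < d \<and> summable H \<and>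
      (\<forall>\<^sub>F i in sequentially. \<forall>s\<in>ball x d \<inter> U. norm (shift_term h y (i + J) s) \<le> H i)" for x
  proof (intro exI conjI)
    define R where "R = norm x + 1"
    \<comment> \<open>From this index on, \<open>s + j\<close> has real part at least \<open>2\<close> for all \<open>s\<close> within distance \<open>1\<close> of \<open>x\<close>.\<close>
    define j0 where "j0 = nat \<lceil>3 - Re x\<rceil>"
    have j0: "Re x - 1 + real j0 \<ge> 2" unfolding j0_def by linarith
    define H where "H = (\<lambda>j. pochhammer R j / fact j * (\<bar>y\<bar> / b) ^ j * (C * b ^ j0))"
    have "summable H" unfolding H_def
      by (rule summable_mult2, rule summable_pochhammer_power) (use b in auto)
    thus "summable (\<lambda>i. H (i + J))" by (rule summable_ignore_initial_segment)
    show "0 < (1::real)" by simp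
    show "\<forall>\<^sub>F i in sequentially. \<forall>s\<in>ball x 1 \<inter> U. norm (shift_term h y (i + J) s) \<le> H (i + J)"
      using eventually_ge_at_top[of j0]
    proof eventually_elim
      case (elim i)
      show ?case
      proof
        fix s assume "s \<in> ball x 1 \<inter> U"
        hence d: "norm (x - s) < 1" by (auto simp: dist_norm)
        have R: "norm s \<le> R" unfolding R_def using d norm_triangle_ineq3[of x s] by linarith
        have "Re s \<ge> Re x - 1" using d abs_Re_le_cmod[of "x - s"] by simp
        hence re: "2 + real (i + J - j0) \<le> Re (s + of_nat (i + J))"
          using j0 elim by (simp add: of_nat_diff)
        have "norm (shift_term h y (i + J) s) =
          norm (pochhammer s (i + J) / fact (i + J) * dirichlet_sum b (s + of_nat (i + J))
              * of_real y ^ (i + J))"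
          by (subst shift_term_eq[OF h(2)]) (use re J in auto)
        also have "\<dots> \<le> pochhammer R (i + J) / fact (i + J) * (C / b ^ (i + J - j0)) * \<bar>y\<bar> ^ (i + J)"
        proof -
          have "norm (pochhammer s (i + J)) \<le> pochhammer R (i + J)"
            using R by (rule norm_pochhammer_le)
          moreover from this have "0 \<le> pochhammer R (i + J)" using norm_ge_zero order.trans by blast
          moreover have "norm (dirichlet_sum b (s + of_nat (i + J))) \<le> C / b ^ (i + J - j0)"
            unfolding C_def using b(1) re by (rule norm_dirichlet_sum_le_power)
          ultimately show ?thesis
            unfolding norm_mult norm_divide norm_fact norm_power norm_of_real
            by (intro mult_right_mono mult_mono divide_right_mono) auto
        qed
        also have "\<dots> = H (i + J)"
        proof -
          have "b ^ (i + J) = b ^ (i + J - j0) * b ^ j0" using elim by (simp flip: power_add)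
          thus ?thesis using b by (simp add: H_def power_divide field_simps)
        qed
        finally show "norm (shift_term h y (i + J) s) \<le> H (i + J)" .
      qed
    qed
  qed
  have "\<exists>g g'. \<forall>s\<in>U. (\<lambda>i. shift_term h y (i + J) s) sums g s \<and>
      (\<lambda>i. deriv (shift_term h y (i + J)) s) sums g' s \<and> (g has_field_derivative g' s) (at s)"
    by (rule series_and_derivative_comparison_local[OF U diff bound])
  then obtain g g' where g: "\<forall>s\<in>U. (\<lambda>i. shift_term h y (i + J) s) sums g s \<and>
      (\<lambda>i. deriv (shift_term h y (i + J)) s) sums g' s \<and> (g has_field_derivative g' s) (at s)" by blast
  show ?thesis
  proof (rule that)
    show "(\<lambda>i. deriv (shift_term h y (i + J)) s) sums deriv g s" if "s \<in> U" for s
      using g that DERIV_imp_deriv[of g "g' s" s] by simp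
    show "g holomorphic_on U" using g U by (auto simp: holomorphic_on_open)
  qed (use g in blast)
qed

lemma halfplane_identity:
  assumes "f holomorphic_on {s. Re s > A}" "g holomorphic_on {s. Re s > A}"
    and "\<And>s. Re s > B \<Longrightarrow> f s = g s" and "Re s > A"
  shows "f s = g s"
proof (rule analytic_continuation_open[of "{s. Re s > max A B}" "{s. Re s > A}" f g])
  show "{s. Re s > max A B} \<noteq> {}"
    by (auto intro!: exI[of _ "of_real (max A B + 1)"])
  show "open {s. Re s > max A B}" by (rule open_halfspace_Re_gt)
  show "connected {s. Re s > A}" by (intro convex_connected convex_halfspace_Re_gt)
qed (use assms in \<open>auto simp: open_halfspace_Re_gt\<close>)

text \<open>
For \<open>b = 2\<close> and \<open>y = 1\<close> the left side of \<open>dirichlet_sum_expansion\<close> minus its term \<open>j = 0\<close> is the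
telescoping sum of \<open>(n+1) powr (-s) - (n+2) powr (-s)\<close>, which is \<open>1\<close>.  With \<open>s - 1\<close> in place of \<open>s\<close>
the term \<open>j = 1\<close> is \<open>h s\<close> itself and the remaining terms contain only \<open>h (s + 1), h (s + 2), \<dots>\<close>.
Solving for \<open>h s\<close> continues \<open>h\<close> by one unit to the left.  At \<open>s = 1\<close> all these remaining terms vanish.
\<close>
lemma unit_shift_recursion:
  assumes h: "h holomorphic_on {s. Re s > A}" "\<And>s. Re s > 1 \<Longrightarrow> h s = (s - 1) * dirichlet_sum 2 s"
    and A: "A \<le> 1"
  obtains k where "k holomorphic_on {s. Re s > A - 1}" "k 1 = 1"
    "\<And>s. Re s > 1 \<Longrightarrow> k s = (s - 1) * dirichlet_sum 2 s"
proof -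
  obtain g where g: "\<And>s. s \<in> {s. Re s > A - 2} \<Longrightarrow> (\<lambda>i. shift_term h 1 (i + 2) s) sums g s"
    "g holomorphic_on {s. Re s > A - 2}"
    by (rule shift_series[of 2 1 2 "{s. Re s > A - 2}" "{s. Re s > A}" h])
       (use h in \<open>auto simp: open_halfspace_Re_gt\<close>)
  define k where "k = (\<lambda>s. 1 - g (s - 1))"
  have hol: "k holomorphic_on {s. Re s > A - 1}"
  proof -
    have "(g \<circ> (\<lambda>s. s - 1)) holomorphic_on {s. Re s > A - 1}"
      by (rule holomorphic_on_compose_gen[OF _ g(2)]) (auto intro!: holomorphic_intros)
    thus ?thesis unfolding k_def o_def by (intro holomorphic_intros)
  qed
  \<comment> \<open>The expansion is used at \<open>s - 1\<close>, which must lie in the half plane of convergence; the identity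
    theorem then lowers the bound to \<open>1\<close>.\<close>
  have eq: "k s = (s - 1) * dirichlet_sum 2 s" if "Re s > 2" for s
  proof -
    define s' where "s' = s - 1"
    have s': "Re s' > 1" using that by (simp add: s'_def)
    obtain S where S: "(\<lambda>n. complex_of_real (real n + 2 - 1) powr (- s')) sums S"
       "(\<lambda>j. pochhammer s' j / fact j * dirichlet_sum 2 (s' + of_nat j) * of_real 1 ^ j) sums S"
      by (rule dirichlet_sum_expansion[of 2 1 s']) (use s' in auto)
    have "(\<lambda>n. complex_of_real (real (Suc n) + 2 - 1) powr (- s'))
        sums (S - complex_of_real (real 0 + 2 - 1) powr (- s'))"
      using S(1) by (subst sums_Suc_iff) simp
    hence "(\<lambda>n. complex_of_real (real n + 2) powr (- s')) sums (S - 1)"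
      by (simp add: algebra_simps)
    moreover have "(\<lambda>n. complex_of_real (real n + 2) powr (- s')) sums dirichlet_sum 2 s'"
      by (rule dirichlet_sums) (use s' in auto)
    ultimately have S1: "S - 1 = dirichlet_sum 2 s'" by (rule sums_unique2)
    have "(\<lambda>j. pochhammer s' (j+2) / fact (j+2) * dirichlet_sum 2 (s' + of_nat (j+2))
        * of_real 1 ^ (j+2)) sums
       (S - (\<Sum>j<2. pochhammer s' j / fact j * dirichlet_sum 2 (s' + of_nat j) * of_real 1 ^ j))"
      using S(2) by (rule sums_split_initial_segment)
    also have "(\<Sum>j<2. pochhammer s' j / fact j * dirichlet_sum 2 (s' + of_nat j) * of_real 1 ^ j) =
        dirichlet_sum 2 s' + s' * dirichlet_sum 2 s"
      by (simp add: eval_nat_numeral s'_def)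
    also have "(\<lambda>j. pochhammer s' (j+2) / fact (j+2) * dirichlet_sum 2 (s' + of_nat (j+2))
        * of_real 1 ^ (j+2)) =
        (\<lambda>j. shift_term h 1 (j + 2) s')"
    proof
      fix j show "pochhammer s' (j+2) / fact (j+2) * dirichlet_sum 2 (s' + of_nat (j+2))
          * of_real 1 ^ (j+2) = shift_term h 1 (j + 2) s'"
        by (rule shift_term_eq[OF h(2), symmetric]) (use s' in auto)
    qed
    finally have "g s' = S - (dirichlet_sum 2 s' + s' * dirichlet_sum 2 s)"
      using g(1)[of s'] s' A by (auto intro: sums_unique2)
    thus ?thesis using S1 by (simp add: k_def s'_def algebra_simps)
  qed
  have D: "(\<lambda>s. (s - 1) * dirichlet_sum 2 s) holomorphic_on {s. Re s > 1}"
    by (intro holomorphic_intros holomorphic_dirichlet_sum) auto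
  show ?thesis
  proof (rule that)
    show "k holomorphic_on {s. Re s > A - 1}" by fact
    show "k s = (s - 1) * dirichlet_sum 2 s" if "Re s > 1" for s
      by (rule halfplane_identity[OF _ D eq that], rule holomorphic_on_subset[OF hol]) (use A in auto)
    have "shift_term h 1 (i + 2) 0 = 0" for i by (simp add: shift_term_def pochhammer_0_left)
    hence "g 0 = 0" using g(1)[of 0] A by (auto dest: sums_unique)
    thus "k 1 = 1" by (simp add: k_def)
  qed
qed

lemma halfplane_continuation:
  "\<exists>h. h holomorphic_on {s. Re s > 1 - real M} \<and>
       (\<forall>s. Re s > 1 \<longrightarrow> h s = (s - 1) * dirichlet_sum 2 s)"
proof (induction M)
  case 0
  have "(\<lambda>s. (s - 1) * dirichlet_sum 2 s) holomorphic_on {s. Re s > 1}"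
    by (intro holomorphic_intros holomorphic_dirichlet_sum) auto
  thus ?case by auto
next
  case (Suc M)
  then obtain h where "h holomorphic_on {s. Re s > 1 - real M}"
    "\<And>s. Re s > 1 \<Longrightarrow> h s = (s - 1) * dirichlet_sum 2 s" by blast
  then obtain k where "k holomorphic_on {s. Re s > 1 - real M - 1}"
    "\<And>s. Re s > 1 \<Longrightarrow> k s = (s - 1) * dirichlet_sum 2 s"
    by (rule unit_shift_recursion) auto
  thus ?case by (intro exI[of _ k]) (auto simp: algebra_simps)
qed

lemma entire_continuation:
  obtains H where "H holomorphic_on UNIV" "H 1 = 1"
    "\<And>s. Re s > 1 \<Longrightarrow> H s = (s - 1) * dirichlet_sum 2 s"
proof -
  obtain h where h: "\<And>M. h M holomorphic_on {s. Re s > 1 - real M}"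
    "\<And>M s. Re s > 1 \<Longrightarrow> h M s = (s - 1) * dirichlet_sum 2 s"
    using halfplane_continuation by metis
  have agree: "h M s = h N s" if "M \<le> N" "Re s > 1 - real M" for M N s
    by (rule halfplane_identity[where B
        = 1, OF h(1) _ _ that(2)], rule holomorphic_on_subset[OF h(1)[of N]])
       (use that h(2) in auto)
  define H where "H = (\<lambda>s. h (nat \<lceil>2 - Re s\<rceil>) s)"
  have H: "H s = h M s" if "Re s > 1 - real M" for s M
  proof -
    have "Re s > 1 - real (nat \<lceil>2 - Re s\<rceil>)" by linarith
    thus ?thesis unfolding H_def using that agree by (metis linear)
  qed
  have "H holomorphic_on {s. Re s > 1 - real M}" for M
    using h(1)[of M] H by (subst holomorphic_cong[OF refl]) auto
  hence "H holomorphic_on (\<Union>M. {s. Re s > 1 - real M})"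
    by (intro holomorphic_on_UN_open) (auto simp: open_halfspace_Re_gt)
  also have "(\<Union>M. {s. Re s > 1 - real M}) = UNIV"
  proof (intro set_eqI iffI UNIV_I)
    fix s show "s \<in> (\<Union>M. {s. Re s > 1 - real M})"
      by (rule UN_I[of "nat \<lceil>2 - Re s\<rceil>"]) (simp, simp, linarith)
  qed
  finally have hol: "H holomorphic_on UNIV" .
  have eq: "H s = (s - 1) * dirichlet_sum 2 s" if "Re s > 1" for s
    using H[of 0 s] h(2) that by simp
  \<comment> \<open>One more step of the recursion, starting from \<open>H\<close> itself, supplies the value at \<open>1\<close>.\<close>
  have "H holomorphic_on {s. Re s > 1}" using hol by (rule holomorphic_on_subset) auto
  then obtain k where k: "k holomorphic_on {s. Re s > 1 - 1}" "k 1 = 1"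
    "\<And>s. Re s > 1 \<Longrightarrow> k s = (s - 1) * dirichlet_sum 2 s"
    by (rule unit_shift_recursion) (use eq in auto)
  have "H 1 = k 1"
    by (rule halfplane_identity[of H 0 k 1], rule holomorphic_on_subset[OF hol]) (use k eq in auto)
  with k(2) show ?thesis using hol eq that by simp
qed

section \<open>The Riemann and Hurwitz zeta functions\<close>

text \<open>
The entire function \<open>(s - 1) * \<zeta>(s)\<close>.  The value at \<open>1\<close> is the residue of zeta.
\<close>
definition regular_zeta :: "complex \<Rightarrow> complex" where
  "regular_zeta s = (if s = 1 then 1 else (s - 1) * riemann_zeta s)"

lemma hurwitz_zeta_eqI:
  assumes "is_hurwitz_continuation a f" "s \<noteq> 1"
  shows "hurwitz_zeta s a = f s"
  unfolding hurwitz_zeta_def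
  by (rule is_hurwitz_continuation_unique[OF someI[of "is_hurwitz_continuation a"] assms(1) assms(2)])
     (rule assms(1))

lemma dirichlet_sum_1_eq:
  assumes "Re s > 1"
  shows "dirichlet_sum 1 s = 1 + dirichlet_sum 2 s"
proof -
  have "(\<lambda>n. complex_of_real (real n + 1) powr (- s)) sums dirichlet_sum 1 s"
    by (rule dirichlet_sums) (use assms in auto)
  hence "(\<lambda>n. complex_of_real (real (Suc n) + 1) powr (- s)) sums
           (dirichlet_sum 1 s - complex_of_real (real 0 + 1) powr (- s))"
    by (subst sums_Suc_iff) simp
  hence "(\<lambda>n. complex_of_real (real n + 2) powr (- s)) sums (dirichlet_sum 1 s - 1)"
    by (simp add: algebra_simps)
  moreover have "(\<lambda>n. complex_of_real (real n + 2) powr (- s)) sums dirichlet_sum 2 s"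
    by (rule dirichlet_sums) (use assms in auto)
  ultimately have "dirichlet_sum 1 s - 1 = dirichlet_sum 2 s" by (rule sums_unique2)
  thus ?thesis by (simp add: algebra_simps)
qed

lemma regular_zeta_properties:
  shows holomorphic_regular_zeta: "regular_zeta holomorphic_on UNIV"
    and regular_zeta_eq_dirichlet: "Re s > 1 \<Longrightarrow> regular_zeta s = (s - 1) * dirichlet_sum 1 s"
proof -
  obtain H where H: "H holomorphic_on UNIV" "H 1 = 1"
    "\<And>s. Re s > 1 \<Longrightarrow> H s = (s - 1) * dirichlet_sum 2 s" by (rule entire_continuation) blast
  define E where "E = (\<lambda>s. (s - 1) + H s)"
  have E: "E holomorphic_on UNIV" unfolding E_def by (intro holomorphic_intros H)
  have eq: "E s = (s - 1) * dirichlet_sum 1 s" if "Re s > 1" for s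
    using H(3)[OF that] dirichlet_sum_1_eq[OF that] by (simp add: E_def algebra_simps)
  have cont: "is_hurwitz_continuation 1 (\<lambda>s. E s / (s - 1))"
    unfolding is_hurwitz_continuation_def
  proof (intro conjI allI impI)
    show "(\<lambda>s. E s / (s - 1)) holomorphic_on - {1}"
      by (intro holomorphic_intros holomorphic_on_subset[OF E]) auto
    fix s :: complex assume s: "Re s > 1"
    hence "s \<noteq> 1" by auto
    hence "E s / (s - 1) = dirichlet_sum 1 s" using eq[OF s] by (simp add: field_simps)
    thus "(\<lambda>n. complex_of_real (real n + 1) powr (- s)) sums (E s / (s - 1))"
      using dirichlet_sums[of 1 s] s by (simp only:)
  qed
  have "regular_zeta s = E s" for s
  proof (cases "s = 1")
    case True
    thus ?thesis using H(2) by (simp add: regular_zeta_def E_def)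
  next
    case False
    thus ?thesis using hurwitz_zeta_eqI[OF cont False]
      by (simp add: regular_zeta_def riemann_zeta_def)
  qed
  hence "regular_zeta = E" by (rule ext)
  thus "regular_zeta holomorphic_on UNIV"
    "Re s > 1 \<Longrightarrow> regular_zeta s = (s - 1) * dirichlet_sum 1 s"
    using E eq by auto
qed

lemma riemann_zeta_eq_regular:
  "s \<noteq> 1 \<Longrightarrow> riemann_zeta s = regular_zeta s / (s - 1)"
  by (simp add: regular_zeta_def)

lemma riemann_zeta_eq_dirichlet:
  "Re s > 1 \<Longrightarrow> riemann_zeta s = dirichlet_sum 1 s"
  using regular_zeta_eq_dirichlet[of s] by (auto simp: regular_zeta_def split: if_splits)

lemma holomorphic_riemann_zeta: "riemann_zeta holomorphic_on -{1}"
proof -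
  have "(\<lambda>s. regular_zeta s / (s - 1)) holomorphic_on -{1}"
    by (intro holomorphic_intros holomorphic_on_subset[OF holomorphic_regular_zeta]) auto
  also have "?this \<longleftrightarrow> ?thesis"
    by (rule holomorphic_cong) (auto simp: riemann_zeta_eq_regular)
  finally show ?thesis .
qed

lemma field_differentiable_riemann_zeta: "s \<noteq> 1 \<Longrightarrow> riemann_zeta field_differentiable at s"
  using holomorphic_riemann_zeta by (rule holomorphic_on_imp_differentiable_at) auto

text \<open>
The right side of the binomial expansion makes sense for all \<open>s \<noteq> 1\<close>, so it is the continuation of
the Hurwitz series.
\<close>
lemma hurwitz_shift_continuation:
  assumes y: "\<bar>y\<bar> < 1"
  obtains g where "g holomorphic_on UNIV"
    "is_hurwitz_continuation (1 - y) (\<lambda>s. riemann_zeta s + g s)"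
    "\<And>s. (\<lambda>i. deriv (shift_term regular_zeta y (i + 1)) s) sums deriv g s"
proof -
  obtain g where g: "\<And>s. s \<in> UNIV \<Longrightarrow> (\<lambda>i. shift_term regular_zeta y (i + 1) s) sums g s"
    "\<And>s. s \<in> UNIV \<Longrightarrow> (\<lambda>i. deriv (shift_term regular_zeta y (i + 1)) s) sums deriv g s"
    "g holomorphic_on UNIV"
    by (rule shift_series[of 1 y 1 UNIV UNIV regular_zeta])
       (use y in \<open>auto intro: holomorphic_regular_zeta regular_zeta_eq_dirichlet\<close>)
  have "is_hurwitz_continuation (1 - y) (\<lambda>s. riemann_zeta s + g s)"
    unfolding is_hurwitz_continuation_def
  proof (intro conjI allI impI)
    show "(\<lambda>s. riemann_zeta s + g s) holomorphic_on - {1}"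
      by (intro holomorphic_intros holomorphic_riemann_zeta holomorphic_on_subset[OF g(3)]) auto
    fix s :: complex assume s: "Re s > 1"
    obtain S where S: "(\<lambda>n. complex_of_real (real n + 1 - y) powr (- s)) sums S"
      "(\<lambda>j. pochhammer s j / fact j * dirichlet_sum 1 (s + of_nat j) * of_real y ^ j) sums S"
      by (rule dirichlet_sum_expansion[of 1 y s]) (use y s in auto)
    have "(\<lambda>j. pochhammer s (j+1) / fact (j+1) * dirichlet_sum 1 (s + of_nat (j+1))
        * of_real y ^ (j+1)) sums
       (S - (\<Sum>j<1. pochhammer s j / fact j * dirichlet_sum 1 (s + of_nat j) * of_real y ^ j))"
      using S(2) by (rule sums_split_initial_segment)
    also have "(\<Sum>j<1. pochhammer s j / fact j * dirichlet_sum 1 (s + of_nat j) * of_real y ^ j) =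
        riemann_zeta s" using s by (simp add: riemann_zeta_eq_dirichlet)
    also have "(\<lambda>j. pochhammer s (j+1) / fact (j+1) * dirichlet_sum 1 (s + of_nat (j+1))
        * of_real y ^ (j+1)) =
        (\<lambda>j. shift_term regular_zeta y (j + 1) s)"
    proof
      fix j show "pochhammer s (j+1) / fact (j+1) * dirichlet_sum 1 (s + of_nat (j+1)) * of_real y ^ (j+1)
        = shift_term regular_zeta y (j + 1) s"
        by (rule shift_term_eq[OF regular_zeta_eq_dirichlet, symmetric]) (use s in auto)
    qed
    finally have "g s = S - riemann_zeta s" using g(1)[of s] by (auto intro: sums_unique2)
    hence "riemann_zeta s + g s = S" by simp
    with S(1) show "(\<lambda>n. complex_of_real (real n + (1 - y)) powr (- s)) sums (riemann_zeta s + g s)"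
      by (simp add: algebra_simps)
  qed
  with g show ?thesis using that by blast
qed

text \<open>
Passing from \<open>1 + a\<close> to \<open>a\<close> adds one summand; this makes the expansion with negative shift usable for
parameters below \<open>1\<close>.
\<close>
lemma hurwitz_continuation_step:
  assumes "is_hurwitz_continuation (1 + a) f" "a > 0"
  shows "is_hurwitz_continuation a (\<lambda>s. complex_of_real a powr (- s) + f s)"
  unfolding is_hurwitz_continuation_def
proof (intro conjI allI impI)
  show "(\<lambda>s. complex_of_real a powr - s + f s) holomorphic_on - {1}"
    using assms by (intro holomorphic_intros) (auto simp: is_hurwitz_continuation_def)
  fix s :: complex assume "Re s > 1"
  hence "(\<lambda>n. complex_of_real (real n + (1 + a)) powr (- s)) sums f s"
    using assms by (auto simp: is_hurwitz_continuation_def)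
  also have "(\<lambda>n. complex_of_real (real n + (1 + a)) powr (- s)) =
      (\<lambda>n. complex_of_real (real (Suc n) + a) powr (- s))"
    by (simp add: algebra_simps)
  finally have "(\<lambda>n. complex_of_real (real n + a) powr - s) sums
      (f s + complex_of_real (real 0 + a) powr - s)"
    by (subst (asm) sums_Suc_iff) simp
  thus "(\<lambda>n. complex_of_real (real n + a) powr - s) sums (complex_of_real a powr - s + f s)"
    by (simp add: add.commute)
qed

lemma hurwitz_zeta'_eq:
  assumes "is_hurwitz_continuation a f" "s \<noteq> 1"
  shows "hurwitz_zeta' s a = deriv f s"
  unfolding hurwitz_zeta'_def
proof (rule deriv_cong_ev)
  have "eventually (\<lambda>z. z \<in> -{1}) (nhds s)"
    using assms(2) by (intro eventually_nhds_in_open) auto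
  thus "\<forall>\<^sub>F z in nhds s. hurwitz_zeta z a = f z"
    by eventually_elim (use assms(1) in \<open>auto intro: hurwitz_zeta_eqI\<close>)
qed auto

section \<open>Differentiating the symmetric expansion\<close>

definition zeta_term :: "real \<Rightarrow> nat \<Rightarrow> complex \<Rightarrow> complex" where
  "zeta_term y j s = pochhammer s j / fact j * riemann_zeta (s + of_nat j) * of_real y ^ j"

text \<open>
At the points considered below, \<open>s + j\<close> is an even integer, so the pole of zeta is avoided and the
regularised terms may be replaced by the original ones.
\<close>
lemma deriv_shift_term_eq:
  assumes "j \<ge> 1" "s + of_nat j \<noteq> 1"
  shows "deriv (shift_term regular_zeta y j) s = deriv (zeta_term y j) s"
proof (rule deriv_cong_ev)
  have "eventually (\<lambda>z. z \<in> -{1 - of_nat j}) (nhds s)"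
    using assms(2) by (intro eventually_nhds_in_open) (auto simp: algebra_simps)
  thus "\<forall>\<^sub>F z in nhds s. shift_term regular_zeta y j z = zeta_term y j z"
  proof eventually_elim
    case (elim z)
    obtain i where j: "j = Suc i" using assms(1) by (cases j) auto
    have "z + of_nat j \<noteq> 1" using elim by (auto simp: algebra_simps)
    thus ?case by (simp add: shift_term_def zeta_term_def regular_zeta_def j pochhammer_Suc mult_ac)
  qed
qed auto

text \<open>
Adding the expansions of \<open>\<zeta>(s, 1 - y)\<close> and of \<open>\<zeta>(s, 1 + y) = \<zeta>(s, y) - y powr (-s)\<close> cancels the odd
powers of \<open>y\<close>.
\<close>
lemma hurwitz_zeta'_symmetric_sums:
  assumes y: "0 < y" "y < 1" and N: "even N"
  shows "(\<lambda>i. deriv (zeta_term y (2 * i)) (- of_nat N)) sums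
           ((hurwitz_zeta' (- of_nat N) (1 - y) + hurwitz_zeta' (- of_nat N) y
               + of_real (ln y) * of_real y ^ N) / 2)"
proof -
  define s :: complex where "s = - of_nat N"
  have ne: "s + of_nat (2 * i) \<noteq> 1" for i
  proof
    assume "s + of_nat (2 * i) = 1"
    hence "(of_nat (2 * i) :: complex) = of_nat (N + 1)" by (simp add: s_def algebra_simps)
    hence "2 * i = N + 1" by (simp only: of_nat_eq_iff)
    with N show False by presburger
  qed
  from ne[of 0] have s1: "s \<noteq> 1" by simp
  obtain g1 where g1: "g1 holomorphic_on UNIV"
    "is_hurwitz_continuation (1 - y) (\<lambda>s. riemann_zeta s + g1 s)"
    "\<And>s. (\<lambda>i. deriv (shift_term regular_zeta y (i + 1)) s) sums deriv g1 s"
    by (rule hurwitz_shift_continuation[of y]) (use y in auto)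
  obtain g2 where g2: "g2 holomorphic_on UNIV"
    "is_hurwitz_continuation (1 + y) (\<lambda>s. riemann_zeta s + g2 s)"
    "\<And>s. (\<lambda>i. deriv (shift_term regular_zeta (-y) (i + 1)) s) sums deriv g2 s"
    by (rule hurwitz_shift_continuation[of "-y"]) (use y in auto)
  have dg: "(g1 has_field_derivative deriv g1 s) (at s)" "(g2 has_field_derivative deriv g2 s) (at s)"
    using g1(1) g2(1) by (auto intro!: holomorphic_derivI)
  have dz: "(riemann_zeta has_field_derivative deriv riemann_zeta s) (at s)"
    using field_differentiable_riemann_zeta[OF s1] by (rule field_differentiable_derivI)
  have "hurwitz_zeta' s (1 - y) = deriv (\<lambda>s. riemann_zeta s + g1 s) s"
    by (rule hurwitz_zeta'_eq[OF g1(2) s1])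
  also have "\<dots> = deriv riemann_zeta s + deriv g1 s"
    by (rule DERIV_imp_deriv) (intro derivative_intros dz dg)
  finally have h1: "hurwitz_zeta' s (1 - y) = deriv riemann_zeta s + deriv g1 s" .
  have "((\<lambda>s. complex_of_real y powr (- s)) has_field_derivative
          Ln (complex_of_real y) * complex_of_real y powr (- s) * (-1)) (at s)"
    by (rule DERIV_chain2[OF has_field_derivative_powr_right]) (use y in \<open>auto intro!:
        derivative_eq_intros\<close>)
  hence dp: "((\<lambda>s. complex_of_real y powr (- s)) has_field_derivative
          - of_real (ln y) * complex_of_real y powr (- s)) (at s)"
    using y by (simp add: Ln_of_real)
  have "hurwitz_zeta' s y = deriv (\<lambda>s. complex_of_real y powr (- s) + (riemann_zeta s + g2 s)) s"
    by (rule hurwitz_zeta'_eq[OF hurwitz_continuation_step[OF g2(2)] s1]) (use y in auto)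
  also have "\<dots> = - of_real (ln y) * of_real y powr (- s) + (deriv riemann_zeta s + deriv g2 s)"
    by (rule DERIV_imp_deriv) (intro derivative_intros dz dg dp)
  also have "complex_of_real y powr (- s) = of_real y ^ N"
    using y by (simp add: s_def powr_nat)
  finally have h2: "hurwitz_zeta' s y =
     - of_real (ln y) * of_real y ^ N + (deriv riemann_zeta s + deriv g2 s)" .
  have diff_t: "deriv (shift_term regular_zeta (-y) j) s
      = (-1) ^ j * deriv (shift_term regular_zeta y j) s" for j
  proof -
    have "shift_term regular_zeta (-y) j = (\<lambda>s. (-1) ^ j * shift_term regular_zeta y j s)"
      by (simp add: shift_term_def fun_eq_iff power_minus[of "complex_of_real y"] mult_ac)
    moreover have "shift_term regular_zeta y j field_differentiable at s"
    proof (rule holomorphic_on_imp_differentiable_at[of _ UNIV])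
      have "(regular_zeta \<circ> (\<lambda>s. s + of_nat j)) holomorphic_on UNIV"
        by (intro holomorphic_on_compose_gen[OF _ holomorphic_regular_zeta] holomorphic_intros) auto
      thus "shift_term regular_zeta y j holomorphic_on UNIV"
        unfolding shift_term_def o_def by (intro holomorphic_intros) auto
    qed auto
    ultimately show ?thesis by simp
  qed
  have "(\<lambda>i. deriv (shift_term regular_zeta y (i + 1)) s + deriv (shift_term regular_zeta (-y) (i + 1)) s)
          sums (deriv g1 s + deriv g2 s)"
    by (intro sums_add g1 g2)
  also have "?this \<longleftrightarrow> (\<lambda>i. deriv (shift_term regular_zeta y ((2 * i + 1) + 1)) s +
      deriv (shift_term regular_zeta (-y) ((2 * i + 1) + 1)) s) sums (deriv g1 s + deriv g2 s)"
  proof (rule sums_mono_reindex[symmetric])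
    show "strict_mono (\<lambda>i::nat. 2 * i + 1)" by (rule strict_monoI) auto
    show "deriv (shift_term regular_zeta y (i + 1)) s + deriv (shift_term regular_zeta (-y) (i
        + 1)) s = 0"
      if "i \<notin> range (\<lambda>i. 2 * i + 1)" for i
    proof -
      have "even i"
      proof (rule ccontr)
        assume "odd i"
        then obtain k where "i = 2 * k + 1" by (elim oddE)
        with that show False by blast
      qed
      thus ?thesis unfolding diff_t by simp
    qed
  qed
  also have "(\<lambda>i. deriv (shift_term regular_zeta y ((2 * i + 1) + 1)) s +
      deriv (shift_term regular_zeta (-y) ((2 * i + 1) + 1)) s) =
      (\<lambda>i. 2 * deriv (zeta_term y (2 * Suc i)) s)"
  proof
    fix i
    have "deriv (shift_term regular_zeta y (2 * Suc i)) s = deriv (zeta_term y (2 * Suc i)) s"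
      by (rule deriv_shift_term_eq[OF _ ne]) auto
    thus "deriv (shift_term regular_zeta y ((2 * i + 1) + 1)) s +
      deriv (shift_term regular_zeta (-y) ((2 * i + 1) + 1)) s = 2 * deriv (zeta_term y (2 * Suc i)) s"
      unfolding diff_t by simp
  qed
  finally have "(\<lambda>i. 2 * deriv (zeta_term y (2 * Suc i)) s / 2) sums ((deriv g1 s + deriv g2 s) / 2)"
    by (rule sums_divide)
  hence "(\<lambda>i. deriv (zeta_term y (2 * i)) s)
      sums ((deriv g1 s + deriv g2 s) / 2 + deriv (zeta_term y (2 * 0)) s)"
    by (subst (asm) nonzero_mult_div_cancel_left, simp) (subst (asm) sums_Suc_iff, simp)
  also have "deriv (zeta_term y (2 * 0)) s = deriv riemann_zeta s"
    by (simp add: zeta_term_def[abs_def])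
  also have "(deriv g1 s + deriv g2 s) / 2 + deriv riemann_zeta s =
      (hurwitz_zeta' s (1 - y) + hurwitz_zeta' s y + of_real (ln y) * of_real y ^ N) / 2"
    unfolding h1 h2 by (simp add: field_simps)
  finally show ?thesis by (simp only: s_def)
qed

lemma has_field_derivative_pochhammer:
  fixes s :: "'a :: {real_normed_field}"
  assumes "\<And>k. k < n \<Longrightarrow> s + of_nat k \<noteq> 0"
  shows "((\<lambda>s. pochhammer s n) has_field_derivative pochhammer s n * (\<Sum>k<n. 1 / (s + of_nat k))) (at s)"
  using assms
proof (induction n)
  case (Suc n)
  show ?case unfolding pochhammer_Suc
    by (rule derivative_eq_intros Suc refl | simp)+ (use Suc.prems[of n] in \<open>simp add: field_simps\<close>)
qed auto

text \<open>
The logarithmic derivative is the sum of the reciprocals of \<open>-N, \<dots>, -1\<close>.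
\<close>
lemma deriv_pochhammer_at_neg:
  "((\<lambda>s :: complex. pochhammer s N)
      has_field_derivative (- ((-1) ^ N * fact N * harm N))) (at (- of_nat N))"
proof -
  have "((\<lambda>s :: complex. pochhammer s N) has_field_derivative
     pochhammer (- of_nat N) N * (\<Sum>k<N. 1 / (- of_nat N + of_nat k))) (at (- of_nat N))"
    by (rule has_field_derivative_pochhammer) (auto simp: add_eq_0_iff)
  also have "(\<Sum>k<N. 1 / (- of_nat N + of_nat k :: complex)) = (\<Sum>k\<in>{1..N}. - inverse (of_nat k))"
    by (rule sum.reindex_bij_witness[of _ "\<lambda>k. N - k" "\<lambda>k. N - k"])
       (auto simp: of_nat_diff field_simps)
  also have "\<dots> = - harm N" by (simp add: harm_def sum_negf)
  also have "pochhammer (- of_nat N :: complex) N = (-1) ^ N * fact N" by (rule pochhammer_same)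
  finally show ?thesis by simp
qed

text \<open>
The factor \<open>s + N\<close> vanishes, so the derivative is the product of the other factors.
\<close>
lemma deriv_pochhammer_beyond:
  "((\<lambda>s :: complex. pochhammer s (N + Suc r))
      has_field_derivative ((-1) ^ N * fact N * fact r)) (at (- of_nat N))"
proof -
  have eq: "(\<lambda>s :: complex. pochhammer s (N + Suc r)) =
     (\<lambda>s. (s + of_nat N) * (pochhammer s N * pochhammer (s + of_nat N + 1) r))"
    by (rule ext, subst pochhammer_product') (simp add: pochhammer_rec mult_ac)
  define F :: "complex \<Rightarrow> complex" where "F = (\<lambda>s. pochhammer s N * pochhammer (s + of_nat N + 1) r)"
  have "F field_differentiable at (- of_nat N)" unfolding F_def
    by (rule holomorphic_on_imp_differentiable_at[of _ UNIV]) (auto intro!: holomorphic_intros)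
  hence "(F has_field_derivative deriv F (- of_nat N)) (at (- of_nat N))"
    by (rule field_differentiable_derivI)
  hence "((\<lambda>s. (s + of_nat N) * F s) has_field_derivative F (- of_nat N)) (at (- of_nat N))"
    by (auto intro!: derivative_eq_intros)
  also have "F (- of_nat N) = (-1) ^ N * fact N * fact r"
    by (simp add: F_def pochhammer_same pochhammer_fact)
  finally show ?thesis unfolding eq F_def .
qed

section \<open>The trapezoid rule to the right of the line Re s = -1\<close>

text \<open>
Two integrations by parts show that \<open>s * (s + 1)\<close> times this integral is the error of the trapezoid
rule for \<open>u powr (-s)\<close> on the interval from \<open>a\<close> to \<open>a + 1\<close>.  The power \<open>(a + v) powr (-s-2)\<close> is written
with \<open>exp\<close> and a real logarithm, so that it is visibly entire in \<open>s\<close>.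
\<close>
definition trapezoid_error :: "real \<Rightarrow> complex \<Rightarrow> complex" where
  "trapezoid_error a s =
     integral {0..1} (\<lambda>v. of_real (v * (1 - v) / 2) * exp (- (s + 2) * of_real (ln (a + v))))"

lemma trapezoid_error_integrable:
  assumes "a \<ge> 1"
  shows "(\<lambda>v. complex_of_real (v * (1 - v) / 2) * exp (- (s + 2) * of_real (ln (a
      + v)))) integrable_on {0..1}"
  by (rule integrable_continuous_interval) (use assms in \<open>auto intro!: continuous_intros\<close>)

lemma trapezoid_error_closed_form:
  assumes a: "a \<ge> 1" and s: "s \<noteq> 1"
  shows "s * (s + 1) * trapezoid_error a s =
     (of_real a powr (- s) + of_real (a + 1) powr (- s)) / 2
     + (of_real (a + 1) powr (1 - s) - of_real a powr (1 - s)) / (s - 1)"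
proof -
  define e where "e = (\<lambda>z (u::real). exp (z * complex_of_real (ln u)))"
  have e_powr: "e z u = of_real u powr z" if "u > 0" for z u
    using that by (simp add: e_def powr_def Ln_of_real)
  have e_deriv: "((\<lambda>v. e z (a + v)) has_vector_derivative (z * e (z - 1) (a + v))) (at v within {0..1})"
    if "v \<in> {0..1}" for z v
  proof -
    have v: "a + v > 0" using that a by auto
    have "((\<lambda>v. complex_of_real (ln (a + v))) has_vector_derivative of_real (1 / (a
        + v))) (at v within {0..1})"
      by (rule has_vector_derivative_of_real) (use v in \<open>auto intro!: derivative_eq_intros\<close>)
    hence "((\<lambda>v. z * complex_of_real (ln (a + v))) has_vector_derivative z * of_real (1 / (a
        + v))) (at v within {0..1})"
      by (rule has_vector_derivative_mult_right)
    hence "((exp \<circ> (\<lambda>v. z * complex_of_real (ln (a + v)))) has_vector_derivative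
             z * of_real (1 / (a + v)) * exp (z * of_real (ln (a + v)))) (at v within {0..1})"
      by (rule field_vector_diff_chain_within) (auto intro!: derivative_eq_intros)
    moreover have "e (z - 1) (a + v) = of_real (1 / (a + v)) * exp (z * of_real (ln (a + v)))"
    proof -
      have "exp (complex_of_real (ln (a + v))) = of_real (a + v)"
        using v by (simp add: exp_of_real del: of_real_add)
      thus ?thesis by (simp add: e_def algebra_simps exp_diff)
    qed
    ultimately show ?thesis by (simp add: o_def e_def mult_ac)
  qed
  \<comment> \<open>The antiderivative given by two integrations by parts, where the kernel has second derivative \<open>-1\<close>.\<close>
  define A where "A = (\<lambda>v::real. of_real (v * (1 - v) / 2) * (-s * e (-s - 1) (a + v))
      - of_real (1 / 2 - v) * e (-s) (a + v) - e (1 - s) (a + v) / (1 - s))"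
  have "((\<lambda>v. s * (s + 1) * (of_real (v * (1 - v) / 2) * exp (- (s + 2) * of_real (ln (a
      + v))))) has_integral
          (A 1 - A 0)) {0..1}"
  proof (rule fundamental_theorem_of_calculus)
    fix v :: real assume v: "v \<in> {0..1}"
    have w: "((\<lambda>v. complex_of_real (v * (1 - v) / 2)) has_vector_derivative of_real (1 / 2
        - v)) (at v within {0..1})"
      by (rule has_vector_derivative_of_real) (auto intro!: derivative_eq_intros simp: field_simps)
    have w': "((\<lambda>v. complex_of_real (1 / 2
        - v)) has_vector_derivative of_real (- 1)) (at v within {0..1})"
      by (rule has_vector_derivative_of_real) (auto intro!: derivative_eq_intros)
    have "(A has_vector_derivative
       (of_real (v * (1 - v) / 2) * (-s * ((-s - 1) * e (-s - 1 - 1) (a + v)))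
          + of_real (1 / 2 - v) * (-s * e (-s - 1) (a + v)))
       - (of_real (1 / 2 - v) * (-s * e (-s - 1) (a + v)) + of_real (-1) * e (-s) (a + v))
       - (1 - s) * e (1 - s - 1) (a + v) / (1 - s)) (at v within {0..1})"
      unfolding A_def
      by (intro has_vector_derivative_diff has_vector_derivative_mult has_vector_derivative_mult_right
            has_vector_derivative_divide w w' e_deriv v)
    also have "(of_real (v * (1 - v) / 2) * (-s * ((-s - 1) * e (-s - 1 - 1) (a + v)))
          + of_real (1 / 2 - v) * (-s * e (-s - 1) (a + v)))
       - (of_real (1 / 2 - v) * (-s * e (-s - 1) (a + v)) + of_real (-1) * e (-s) (a + v))
       - (1 - s) * e (1 - s - 1) (a + v) / (1 - s) =
       s * (s + 1) * (of_real (v * (1 - v) / 2) * e (- s - 1 - 1) (a + v))"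
    proof -
      have alg: "(w * (-s * ((-s - 1) * x2)) + p * (-s * x1)) - (p * (-s * x1)
          + complex_of_real (-1) * x0) - x0
          = s * (s + 1) * (w * x2)" for w p x0 x1 x2 :: complex
        by (simp add: algebra_simps)
      have eq: "(1 - s) * e (1 - s - 1) (a + v) / (1 - s) = e (-s) (a + v)" using s by simp
      show ?thesis unfolding eq by (rule alg)
    qed
    also have "e (- s - 1 - 1) (a + v) = exp (- (s + 2) * of_real (ln (a + v)))"
      by (simp add: e_def algebra_simps)
    finally show "(A has_vector_derivative
      s * (s + 1) * (of_real (v * (1 - v) / 2) * exp (- (s + 2) * of_real (ln (a
          + v))))) (at v within {0..1})" .
  qed auto
  moreover have "((\<lambda>v. s * (s + 1) * (of_real (v * (1 - v) / 2) * exp (- (s + 2) * of_real (ln (a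
      + v))))) has_integral
          s * (s + 1) * trapezoid_error a s) {0..1}"
    unfolding trapezoid_error_def
    by (intro has_integral_mult_right integrable_integral trapezoid_error_integrable a)
  ultimately have "A 1 - A 0 = s * (s + 1) * trapezoid_error a s"
    by (rule has_integral_unique)
  hence "s * (s + 1) * trapezoid_error a s = A 1 - A 0" ..
  also have "\<dots> = (e (-s) a + e (-s) (a + 1)) / 2 + (e (1 - s) (a + 1) - e (1 - s) a) / (s - 1)"
  proof -
    have c: "x / (1 - s) = - (x / (s - 1))" for x
      by (metis minus_diff_eq minus_divide_right)
    show ?thesis by (simp add: A_def c add_divide_distrib diff_divide_distrib)
  qed
  finally show ?thesis using a by (simp add: e_powr)
qed

text \<open>
At \<open>s = 1\<close> the closed form above has a removable singularity: the integral of \<open>1 / u\<close> is a logarithm.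
\<close>
lemma trapezoid_error_at_1:
  assumes a: "a \<ge> 1"
  shows "2 * trapezoid_error a 1 = of_real ((1 / a + 1 / (a + 1)) / 2 - (ln (a + 1) - ln a))"
proof -
  \<comment> \<open>The antiderivative from the proof above, with the power \<open>u powr (1 - s) / (1 - s)\<close> replaced by
    \<open>ln u\<close>.\<close>
  define A where "A = (\<lambda>v::real. - (v * (1 - v) / 2) / (a + v)\<^sup>2 - (1 / 2 - v) / (a + v) - ln (a + v))"
  have "((\<lambda>v. 2 * (v * (1 - v) / 2) / (a + v) ^ 3) has_integral (A 1 - A 0)) {0..1}"
  proof (rule fundamental_theorem_of_calculus)
    fix v :: real assume v: "v \<in> {0..1}"
    have "(A has_real_derivative 2 * (v * (1 - v) / 2) / (a + v) ^ 3) (at v within {0..1})"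
    proof -
      have u: "a + v > 0" using a v by auto
      have "((\<lambda>v. - (v * (1 - v) / 2) / (a + v)\<^sup>2 - (1 / 2 - v) / (a + v) - ln (a
          + v)) has_real_derivative
          ((- ((1 - 2 * v) / 2)) * (a + v)\<^sup>2 - (- (v * (1 - v) / 2)) * (2 * (a + v))) / ((a + v)\<^sup>2
              * (a + v)\<^sup>2)
          - ((-1) * (a + v) - (1 / 2 - v)) / ((a + v) * (a + v)) - 1 / (a + v)) (at v within {0..1})"
      proof -
        have 1: "((\<lambda>v. - (v * (1 - v) / 2))
            has_real_derivative (- ((1 - 2 * v) / 2))) (at v within {0..1})"
          by (auto intro!: derivative_eq_intros)
        have 2: "((\<lambda>v. (a + v)\<^sup>2) has_real_derivative 2 * (a + v)) (at v within {0..1})"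
          by (auto intro!: derivative_eq_intros)
        have 3: "((\<lambda>v. 1 / 2 - v) has_real_derivative (-1)) (at v within {0..1})"
          by (auto intro!: derivative_eq_intros)
        have 4: "((\<lambda>v. a + v) has_real_derivative 1) (at v within {0..1})"
          by (auto intro!: derivative_eq_intros)
        have 5: "((\<lambda>v. ln (a + v)) has_real_derivative 1 / (a + v)) (at v within {0..1})"
          using u by (auto intro!: derivative_eq_intros)
        have 6: "((\<lambda>v. (1 / 2 - v) / (a + v)) has_real_derivative
            ((-1) * (a + v) - (1 / 2 - v)) / ((a + v) * (a + v))) (at v within {0..1})"
          using DERIV_divide[OF 3 4] u by simp
        have 7: "(a + v)\<^sup>2 \<noteq> 0" using u by simp
        show ?thesis by (intro DERIV_diff DERIV_divide[OF 1 2 7] 6 5)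
      qed
      also have "((- ((1 - 2 * v) / 2)) * (a + v)\<^sup>2 - (- (v * (1 - v) / 2)) * (2 * (a + v))) / ((a
          + v)\<^sup>2 * (a + v)\<^sup>2)
          - ((-1) * (a + v) - (1 / 2 - v)) / ((a + v) * (a + v)) - 1 / (a + v)
              = 2 * (v * (1 - v) / 2) / (a + v) ^ 3"
      proof -
        have "((- ((1 - 2 * v) / 2)) * u\<^sup>2 - (- (v * (1 - v) / 2)) * (2 * u)) / (u\<^sup>2 * u\<^sup>2)
          - ((-1) * u - (1 / 2 - v)) / (u * u) - 1 / u = 2 * (v * (1 - v) / 2) / u ^ 3" if "u > 0" for u
          using that by (simp add: divide_simps power2_eq_square power3_eq_cube) (simp add: algebra_simps)
        thus ?thesis using u by blast
      qed
      finally show ?thesis unfolding A_def .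
    qed
    thus "(A has_vector_derivative 2 * (v * (1 - v) / 2) / (a + v) ^ 3) (at v within {0..1})"
      by (simp add: has_real_derivative_iff_has_vector_derivative)
  qed auto
  hence F: "((\<lambda>v. complex_of_real (2 * (v * (1 - v) / 2) / (a + v) ^ 3))
      has_integral of_real (A 1 - A 0)) {0..1}"
    by (rule has_integral_of_real)
  have "((\<lambda>v. 2 * (of_real (v * (1 - v) / 2) * exp (- (1 + 2) * of_real (ln (a + v))))) has_integral
     2 * trapezoid_error a 1) {0..1}"
    unfolding trapezoid_error_def
    by (intro has_integral_mult_right integrable_integral trapezoid_error_integrable a)
  hence "((\<lambda>v. complex_of_real (2 * (v * (1 - v) / 2) / (a + v) ^ 3))
      has_integral 2 * trapezoid_error a 1) {0..1}"
  proof (rule has_integral_eq[rotated])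
    fix v :: real assume v: "v \<in> {0..1}"
    have "exp (- (1 + 2) * complex_of_real (ln (a + v))) = of_real (exp (- (3 * ln (a + v))))"
      by (simp add: exp_of_real[symmetric])
    also have "exp (- (3 * ln (a + v))) = 1 / (a + v) ^ 3"
      using v a exp_of_nat_mult[of 3 "ln (a + v)"] by (simp add: exp_minus field_simps)
    finally show "2 * (of_real (v * (1 - v) / 2) * exp (- (1 + 2) * complex_of_real (ln (a + v)))) =
       complex_of_real (2 * (v * (1 - v) / 2) / (a + v) ^ 3)" by simp
  qed
  with F have "of_real (A 1 - A 0) = 2 * trapezoid_error a 1" by (rule has_integral_unique)
  hence "2 * trapezoid_error a 1 = of_real (A 1 - A 0)" ..
  also have "A 1 - A 0 = (1 / a + 1 / (a + 1)) / 2 - (ln (a + 1) - ln a)"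
    using a by (simp add: A_def divide_simps) (simp add: algebra_simps)
  finally show ?thesis .
qed

lemma norm_trapezoid_error_le:
  assumes a: "a \<ge> 1" and "1 + d \<le> Re s + 2" "d > 0"
  shows "norm (trapezoid_error a s) \<le> a powr (-(1 + d))"
proof -
  have "norm (trapezoid_error a s) \<le> integral {0..1} (\<lambda>v::real. a powr (-(1 + d)))"
    unfolding trapezoid_error_def
  proof (rule integral_norm_bound_integral)
    fix v :: real assume v: "v \<in> {0..1}"
    have "v * (1 - v) \<le> 1 * 1" using v by (intro mult_mono) auto
    hence w: "\<bar>v * (1 - v) / 2\<bar> \<le> 1" using v by (simp add: abs_mult)
    have "norm (exp (- (s + 2) * of_real (ln (a + v)))) = exp (- ((Re s + 2) * ln (a + v)))"
      by (simp add: norm_exp_eq_Re algebra_simps)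
    also have "\<dots> \<le> exp (- ((1 + d) * ln a))"
    proof -
      have "(1 + d) * ln a \<le> (Re s + 2) * ln (a + v)"
        using assms v by (intro mult_mono) auto
      thus ?thesis by simp
    qed
    also have "\<dots> = a powr (-(1 + d))" using a by (simp add: powr_def algebra_simps)
    finally show "norm (of_real (v * (1 - v) / 2) * exp (- (s + 2) * of_real (ln (a + v))))
        \<le> a powr (-(1 + d))"
      using w unfolding norm_mult norm_of_real
          by (smt (verit) mult_left_le_one_le norm_ge_zero abs_ge_zero)
  qed (use trapezoid_error_integrable[OF a] in auto)
  thus ?thesis by simp
qed

lemma holomorphic_trapezoid_error:
  assumes a: "a \<ge> 1"
  shows "trapezoid_error a holomorphic_on UNIV"
proof -
  have "(\<lambda>s. integral (cbox 0 (1::real)) (\<lambda>v. of_real (v * (1 - v) / 2) * exp (- (s + 2)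
      * of_real (ln (a + v)))))
    holomorphic_on UNIV"
  proof (rule leibniz_rule_holomorphic)
    show "((\<lambda>s. of_real (v * (1 - v) / 2) * exp (- (s + 2) * of_real (ln (a + v)))) has_field_derivative
       of_real (v * (1 - v) / 2) * (- of_real (ln (a + v)) * exp (- (s + 2) * of_real (ln (a
           + v))))) (at s within UNIV)"
      for s v by (auto intro!: derivative_eq_intros)
    show "continuous_on (UNIV \<times> cbox 0 1) (\<lambda>(s, v). complex_of_real (v * (1 - v) / 2) *
       (- of_real (ln (a + v)) * exp (- (s + 2) * of_real (ln (a + v)))))"
      unfolding case_prod_unfold by (intro continuous_intros) (use a in auto)
  qed (use trapezoid_error_integrable[OF a] in auto)
  thus ?thesis by (simp add: trapezoid_error_def[abs_def])
qed

text \<open>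
Summing the trapezoid errors of \<open>u powr (-s)\<close> over all intervals from \<open>n + 1\<close> to \<open>n + 2\<close> gives
\<open>\<zeta>(s) - 1/2 - 1/(s-1)\<close> when \<open>Re s > 1\<close>.  The errors are of order \<open>n powr (-Re s - 2)\<close>, so the
identity extends to \<open>Re s > -1\<close>.
\<close>
lemma regular_zeta_trapezoid:
  obtains C where "C holomorphic_on {s. Re s > -1}"
    "\<And>s. Re s > -1 \<Longrightarrow> (\<lambda>n. s * (s + 1) * trapezoid_error (real (Suc n)) s) sums C s"
    "\<And>s. Re s > -1 \<Longrightarrow> regular_zeta s = (s + 1) / 2 + (s - 1) * C s"
proof -
  let ?S = "{s. Re s > -1}"
  let ?f = "\<lambda>n s. s * (s + 1) * trapezoid_error (real (Suc n)) s"
  have op: "open ?S" by (rule open_halfspace_Re_gt)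
  have diff: "(?f n has_field_derivative deriv (?f n) s) (at s)" for n s
  proof -
    have "?f n holomorphic_on UNIV" by (intro holomorphic_intros holomorphic_trapezoid_error) auto
    thus ?thesis by (rule holomorphic_derivI) auto
  qed
  have bound: "\<exists>d h. 0 < d \<and> summable h \<and> (\<forall>\<^sub>F n in sequentially. \<forall>s\<in>ball x d \<inter> ?S. norm (?f n s) \<le> h n)"
    if x: "x \<in> ?S" for x
  proof (intro exI conjI always_eventually allI ballI)
    \<comment> \<open>The ball of this radius stays in \<open>Re s > d - 1\<close>, where the errors are bounded by \<open>n powr (-(1
      + d))\<close>.\<close>
    define d where "d = (Re x + 1) / 2"
    define R where "R = norm x + d"
    show d: "d > 0" using x by (simp add: d_def)
    have "summable (\<lambda>n. real (Suc n) powr (-(1 + d)))"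
      using d by (subst summable_Suc_iff) (simp add: summable_real_powr_iff)
    thus "summable (\<lambda>n. R * (R + 1) * real (Suc n) powr (-(1 + d)))" by (rule summable_mult)
    fix n s assume "s \<in> ball x d \<inter> ?S"
    hence xs: "norm (x - s) < d" by (auto simp: dist_norm)
    hence R: "norm s \<le> R" unfolding R_def using norm_triangle_ineq3[of x s] by linarith
    moreover have "norm (s + 1) \<le> R + 1" using R norm_triangle_ineq[of s 1] by simp
    moreover have "norm (trapezoid_error (real (Suc n)) s) \<le> real (Suc n) powr (-(1 + d))"
    proof (rule norm_trapezoid_error_le)
      have "\<bar>Re x - Re s\<bar> < d" using xs abs_Re_le_cmod[of "x - s"] by simp
      hence "Re x - Re s < d" by (simp add: abs_less_iff)
      thus "1 + d \<le> Re s + 2" by (simp add: d_def field_simps)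
    qed (use d in auto)
    ultimately show "norm (?f n s) \<le> R * (R + 1) * real (Suc n) powr (-(1 + d))"
      unfolding norm_mult using order.trans[OF norm_ge_zero R] by (intro mult_mono) auto
  qed
  have "\<exists>g g'. \<forall>s\<in>?S. (\<lambda>n. ?f n s) sums g s \<and> (\<lambda>n. deriv (?f n) s) sums g' s \<and>
      (g has_field_derivative g' s) (at s)"
    by (rule series_and_derivative_comparison_local[OF op diff bound])
  then obtain C g' where C: "\<forall>s\<in>?S. (\<lambda>n. ?f n s) sums C s \<and> (\<lambda>n. deriv (?f n) s) sums g' s \<and>
      (C has_field_derivative g' s) (at s)" by blast
  have hol: "C holomorphic_on ?S" using C op by (auto simp: holomorphic_on_open)
  have sums: "(\<lambda>n. ?f n s) sums C s" if "Re s > -1" for s using C that by blast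
  have eq: "regular_zeta s = (s + 1) / 2 + (s - 1) * C s" if s: "Re s > 1" for s
  proof -
    have s1: "s \<noteq> 1" using s by auto
    let ?Z = "dirichlet_sum 1 s"
    have Z: "(\<lambda>n. of_real (real (Suc n)) powr (- s)) sums ?Z"
      using dirichlet_sums[of 1 s] s by (simp add: add.commute)
    have Z': "(\<lambda>n. of_real (real (Suc (Suc n))) powr (- s)) sums (?Z - 1)"
      using Z by (subst sums_Suc_iff) simp
    have "(\<lambda>n. norm (complex_of_real (real (Suc n)) powr (1 - s))) \<longlonglongrightarrow> 0"
    proof -
      have "(\<lambda>n. real (Suc n) powr (1 - Re s)) \<longlonglongrightarrow> 0"
      proof (rule tendsto_neg_powr)
        show "filterlim (\<lambda>n. real (Suc n)) at_top sequentially"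
          by (rule filterlim_compose[OF filterlim_real_sequentially filterlim_Suc])
      qed (use s in auto)
      thus ?thesis by (subst norm_of_real_powr) auto
    qed
    hence "(\<lambda>n. complex_of_real (real (Suc n)) powr (1 - s)) \<longlonglongrightarrow> 0"
      by (rule tendsto_norm_zero_cancel)
    from telescope_sums[OF this] have T: "(\<lambda>n. complex_of_real (real (Suc (Suc n))) powr (1 - s) -
        of_real (real (Suc n)) powr (1 - s)) sums (0 - 1)" by simp
    have "(\<lambda>n. (of_real (real (Suc n)) powr (- s) + of_real (real (Suc (Suc n))) powr (- s)) / 2
        + (of_real (real (Suc (Suc n))) powr (1 - s) - of_real (real (Suc n)) powr (1 - s)) / (s - 1))
        sums ((?Z + (?Z - 1)) / 2 + (0 - 1) / (s - 1))"
      by (intro sums_add sums_divide Z Z' T)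
    also have "(\<lambda>n. (of_real (real (Suc n)) powr (- s) + of_real (real (Suc (Suc n))) powr (- s)) / 2
        + (of_real (real (Suc (Suc n))) powr (1 - s) - of_real (real (Suc n)) powr (1 - s)) / (s
            - 1)) = (\<lambda>n. ?f n s)"
    proof
      fix n
      have "real (Suc (Suc n)) = real (Suc n) + 1" by simp
      thus "(of_real (real (Suc n)) powr (- s) + of_real (real (Suc (Suc n))) powr (- s)) / 2
        + (of_real (real (Suc (Suc n))) powr (1 - s) - of_real (real (Suc n)) powr (1 - s)) / (s
            - 1) = ?f n s"
        by (subst trapezoid_error_closed_form) (use s1 in \<open>simp_all only:, auto\<close>)
    qed
    finally have "C s = (?Z + (?Z - 1)) / 2 + (0 - 1) / (s - 1)"
      using sums[of s] s by (auto intro: sums_unique2)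
    also have "(?Z + (?Z - 1)) / 2 = ?Z - 1 / 2" by (simp add: diff_divide_distrib)
    finally have "(s - 1) * C s = (s - 1) * (?Z - 1 / 2) + (s - 1) * ((0 - 1) / (s - 1))"
      by (simp only: distrib_left)
    also have "(s - 1) * ((0 - 1) / (s - 1)) = -1" using s1 by simp
    finally show ?thesis unfolding regular_zeta_eq_dirichlet[OF s] by (simp add: field_simps)
  qed
  have "regular_zeta s = (s + 1) / 2 + (s - 1) * C s" if "Re s > -1" for s
    by (rule halfplane_identity[where B = 1 and f = regular_zeta and g
        = "\<lambda>s. (s + 1) / 2 + (s - 1) * C s", OF _ _ eq that],
        rule holomorphic_on_subset[OF holomorphic_regular_zeta])
       (auto intro!: holomorphic_intros hol)
  with hol sums that show ?thesis by blast
qed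

text \<open>
By the trapezoid series the derivative is \<open>1/2 + C 1\<close>, and \<open>C 1\<close> is, up to a telescoping sum, the
series for Euler's constant.
\<close>
lemma deriv_regular_zeta_1: "(regular_zeta has_field_derivative euler_mascheroni) (at 1)"
proof -
  obtain C where C: "C holomorphic_on {s. Re s > -1}"
    "\<And>s. Re s > -1 \<Longrightarrow> (\<lambda>n. s * (s + 1) * trapezoid_error (real (Suc n)) s) sums C s"
    "\<And>s. Re s > -1 \<Longrightarrow> regular_zeta s = (s + 1) / 2 + (s - 1) * C s"
    by (rule regular_zeta_trapezoid) blast
  have "(\<lambda>n. complex_of_real ((inverse (real (n+1)) + ln (real (n+1)) - ln (real (n+2)))
      + (1 / 2) * (inverse (real (Suc (Suc n))) - inverse (real (Suc n)))))
     sums of_real (euler_mascheroni + (1 / 2) * (0 - inverse (real (Suc 0))))"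
    by (intro sums_of_real sums_add sums_mult euler_mascheroni_sum_real telescope_sums
        LIMSEQ_inverse_real_of_nat)
  also have "(\<lambda>n. complex_of_real ((inverse (real (n+1)) + ln (real (n+1)) - ln (real (n+2)))
      + (1 / 2) * (inverse (real (Suc (Suc n))) - inverse (real (Suc n))))) =
      (\<lambda>n. 1 * (1 + 1) * trapezoid_error (real (Suc n)) 1)"
  proof
    fix n
    have "2 * trapezoid_error (real (Suc n)) 1
        = of_real ((1 / real (Suc n) + 1 / (real (Suc n) + 1)) / 2 - (ln (real (Suc n) + 1)
            - ln (real (Suc n))))"
      by (rule trapezoid_error_at_1) auto
    also have "(1 / real (Suc n) + 1 / (real (Suc n) + 1)) / 2 - (ln (real (Suc n) + 1)
        - ln (real (Suc n))) =
       (inverse (real (n+1)) + ln (real (n+1)) - ln (real (n+2)))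
      + (1 / 2) * (inverse (real (Suc (Suc n))) - inverse (real (Suc n)))"
    proof -
      have alg: "(p + q) / 2 - (b - c) = p + c - b + 1 / 2 * (q - p)" for p q b c :: real
        by (simp add: field_simps)
      have "real (Suc n) = real (n + 1)" "real (Suc n) + 1 = real (n + 2)" "real (Suc (Suc n))
          = real (n + 2)"
        by simp_all
      thus ?thesis unfolding inverse_eq_divide by (simp only: alg)
    qed
    finally show "complex_of_real ((inverse (real (n+1)) + ln (real (n+1)) - ln (real (n+2)))
      + (1 / 2) * (inverse (real (Suc (Suc n))) - inverse (real (Suc n))))
          = 1 * (1 + 1) * trapezoid_error (real (Suc n)) 1"
      by simp
  qed
  finally have C1: "C 1 = of_real (euler_mascheroni - 1 / 2)"
    using C(2)[of 1] by (auto dest: sums_unique2)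
  have "(C has_field_derivative deriv C 1) (at 1)"
    by (rule holomorphic_derivI[OF C(1)]) (auto simp: open_halfspace_Re_gt)
  hence "((\<lambda>s. (s + 1) / 2 + (s - 1) * C s) has_field_derivative (1 / 2 + C 1)) (at 1)"
    by (auto intro!: derivative_eq_intros)
  hence "(regular_zeta has_field_derivative (1 / 2 + C 1)) (at 1)"
    by (rule has_field_derivative_transform_within_open[of _ _ _ "{s. Re s > -1}"])
       (auto simp: open_halfspace_Re_gt C(3))
  thus ?thesis by (simp add: C1)
qed

section \<open>Partial fractions of the hyperbolic cotangent\<close>

text \<open>
The logarithmic derivative of the reflection formula of the Gamma function.
\<close>
lemma Digamma_reflection:
  fixes z :: complex
  assumes z: "z \<notin> \<int>"
  shows "Digamma (1 - z) - Digamma z = of_real pi * cos (of_real pi * z) / sin (of_real pi * z)"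
proof -
  have z1: "1 - z \<notin> \<int>" 
  proof
    assume "1 - z \<in> \<int>"
    hence "1 - (1 - z) \<in> \<int>" by (intro Ints_diff) auto
    thus False using z by simp
  qed
  have nz: "z \<notin> \<int>\<^sub>\<le>\<^sub>0" "1 - z \<notin> \<int>\<^sub>\<le>\<^sub>0" using z z1 nonpos_Ints_subset_Ints by blast+
  have s: "sin (of_real pi * z) \<noteq> 0"
    using z by (auto simp: sin_eq_0 mult.commute)
  have G: "Gamma z * Gamma (1 - z) = of_real pi / sin (of_real pi * z)"
    by (rule Gamma_reflection_complex)
  have d1: "((\<lambda>z. Gamma (1 - z)) has_field_derivative (Gamma (1 - z) * Digamma (1 - z)) * (-1)) (at z)"
    by (rule DERIV_chain2[OF has_field_derivative_Gamma]) (use nz in \<open>auto intro!: derivative_eq_intros\<close>)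
  have "((\<lambda>z. Gamma z * Gamma (1 - z)) has_field_derivative
      ((Gamma z * Digamma z) * Gamma (1 - z) + (Gamma (1 - z) * Digamma (1 - z)) * (-1)
          * Gamma z)) (at z)"
    by (rule DERIV_mult[OF has_field_derivative_Gamma d1]) (use nz in auto)
  also have "(\<lambda>z. Gamma z * Gamma (1 - z)) = (\<lambda>z :: complex. of_real pi / sin (of_real pi * z))"
    by (intro ext Gamma_reflection_complex)
  also have "(Gamma z * Digamma z) * Gamma (1 - z) + (Gamma (1 - z) * Digamma (1 - z)) * (-1) * Gamma z =
      (Gamma z * Gamma (1 - z)) * (Digamma z - Digamma (1 - z))"
    by (simp add: algebra_simps)
  finally have D1: "((\<lambda>z :: complex. of_real pi / sin (of_real pi * z)) has_field_derivative
      of_real pi / sin (of_real pi * z) * (Digamma z - Digamma (1 - z))) (at z)" unfolding G .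
  have ds: "((\<lambda>z. sin (of_real pi * z)) has_field_derivative cos (of_real pi * z) * of_real pi) (at z)"
    by (rule DERIV_chain2[OF DERIV_sin]) (auto intro!: derivative_eq_intros)
  have D2: "((\<lambda>z :: complex. of_real pi / sin (of_real pi * z)) has_field_derivative
      (0 * sin (of_real pi * z) - of_real pi * (cos (of_real pi * z) * of_real pi))
          / (sin (of_real pi * z) * sin (of_real pi * z))) (at z)"
    by (rule DERIV_divide[OF DERIV_const ds s])
  have "of_real pi / sin (of_real pi * z) * (Digamma z - Digamma (1 - z)) =
      (0 * sin (of_real pi * z) - of_real pi * (cos (of_real pi * z) * of_real pi))
          / (sin (of_real pi * z) * sin (of_real pi * z))"
    by (rule DERIV_unique[OF D1 D2])
  note eq = this
  have solve: "X = - (p * c / S)" if "p / S * X = (0 * S - p * (c * p)) / (S * S)" "p \<noteq> 0" "S \<noteq> 0"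
    for X p c S :: complex
  proof -
    have "X = S / p * (p / S * X)" using that(2,3) by simp
    also have "\<dots> = S / p * ((0 * S - p * (c * p)) / (S * S))" by (simp only: that(1))
    also have "\<dots> = - (p * c / S)" using that(2,3) by (simp add: field_simps)
    finally show ?thesis .
  qed
  have "Digamma z - Digamma (1 - z) = - (of_real pi * cos (of_real pi * z) / sin (of_real pi * z))"
    by (rule solve[OF eq]) (use s in auto)
  hence "- (Digamma z - Digamma (1 - z)) = of_real pi * cos (of_real pi * z) / sin (of_real pi * z)"
    by simp
  thus ?thesis by simp
qed

lemma Digamma_sums:
  fixes z :: complex
  assumes "z \<noteq> 0"
  shows "(\<lambda>k. inverse (of_nat (Suc k)) - inverse (z + of_nat k)) sums (Digamma z + euler_mascheroni)"
  using summable_sums[OF summable_Digamma[OF assms]] by (simp add: Digamma_def)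

text \<open>
The previous lemma at \<open>z = \<i> * \<tau>\<close>.  Replacing \<open>Digamma z\<close> by \<open>Digamma (1 + z) - 1 / z\<close> makes
the series for the two Digamma values combine into conjugate pairs.
\<close>
lemma coth_partial_fractions:
  fixes \<tau> :: real
  assumes \<tau>: "\<tau> > 0"
  shows "(\<lambda>n. 2 * \<tau> / ((real (Suc n))\<^sup>2 + \<tau>\<^sup>2)) sums (pi * cosh (pi * \<tau>) / sinh (pi * \<tau>) - 1 / \<tau>)"
proof -
  define z where "z = \<i> * complex_of_real \<tau>"
  have z: "z \<notin> \<int>" using \<tau> by (auto simp: z_def elim!: Ints_cases dest!: arg_cong[of _ _ Im])
  have nz: "z \<noteq> 0" "1 + z \<noteq> 0" "1 - z \<noteq> 0"
    using \<tau> by (auto simp: z_def complex_eq_iff)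
  have "(\<lambda>k. (inverse (of_nat (Suc k)) - inverse ((1 - z) + of_nat k)) -
            (inverse (of_nat (Suc k)) - inverse ((1 + z) + of_nat k))) sums
        ((Digamma (1 - z) + euler_mascheroni) - (Digamma (1 + z) + euler_mascheroni))"
    by (intro sums_diff Digamma_sums nz)
  also have "Digamma (1 + z) = Digamma z + 1 / z"
    using Digamma_plus1[OF nz(1)] by (simp add: add.commute)
  finally have "(\<lambda>k. \<i> * ((inverse (of_nat (Suc k)) - inverse ((1 - z) + of_nat k)) -
            (inverse (of_nat (Suc k)) - inverse ((1 + z) + of_nat k)))) sums
        (\<i> * ((Digamma (1 - z) + euler_mascheroni) - (Digamma z + 1 / z + euler_mascheroni)))"
    by (rule sums_mult)
  also have "(\<i> * ((Digamma (1 - z) + euler_mascheroni) - (Digamma z + 1 / z + euler_mascheroni))) =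
      \<i> * ((Digamma (1 - z) - Digamma z) - 1 / z)" by (simp add: algebra_simps)
  also have "Digamma (1 - z) - Digamma z = of_real pi * cos (of_real pi * z) / sin (of_real pi * z)"
    by (rule Digamma_reflection[OF z])
  also have "cos (of_real pi * z) = cosh (complex_of_real (pi * \<tau>))"
    by (simp add: cosh_conv_cos z_def mult_ac)
  also have "\<dots> = of_real (cosh (pi * \<tau>))" by (simp add: cosh_field_def flip: exp_of_real)
  also have "sin (of_real pi * z) = \<i> * sinh (complex_of_real (pi * \<tau>))"
    by (simp add: sinh_conv_sin z_def mult_ac)
  also have "sinh (complex_of_real (pi * \<tau>)) = of_real (sinh (pi * \<tau>))"
      by (simp add: sinh_field_def flip: exp_of_real)
  also have "\<i> * (of_real pi * of_real (cosh (pi * \<tau>)) / (\<i> * of_real (sinh (pi * \<tau>))) - 1 / z) =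
      complex_of_real (pi * cosh (pi * \<tau>) / sinh (pi * \<tau>) - 1 / \<tau>)"
    by (simp add: z_def algebra_simps)
  also have "(\<lambda>k. \<i> * ((inverse (of_nat (Suc k)) - inverse ((1 - z) + of_nat k)) -
            (inverse (of_nat (Suc k)) - inverse ((1 + z) + of_nat k)))) =
      (\<lambda>k. complex_of_real (2 * \<tau> / ((real (Suc k))\<^sup>2 + \<tau>\<^sup>2)))"
  proof
    fix k
    define N where "N = real (Suc k)"
    have N: "N > 0" by (simp add: N_def)
    have pos: "N\<^sup>2 + \<tau>\<^sup>2 > 0" using N by (simp add: add_pos_nonneg)
    have e1: "(1 - z) + of_nat k = Complex N (- \<tau>)" "(1 + z) + of_nat k = Complex N \<tau>"
      by (simp_all add: complex_eq_iff z_def N_def)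
    have "\<i> * ((inverse (of_nat (Suc k)) - inverse (Complex N (- \<tau>))) -
            (inverse (of_nat (Suc k)) - inverse (Complex N \<tau>))) =
       \<i> * (inverse (Complex N \<tau>) - inverse (Complex N (- \<tau>)))" by simp
    also have "\<dots> = complex_of_real (2 * \<tau> / (N\<^sup>2 + \<tau>\<^sup>2))"
      using pos by (simp add: complex_eq_iff)
    finally show "\<i> * ((inverse (of_nat (Suc k)) - inverse ((1 - z) + of_nat k)) -
            (inverse (of_nat (Suc k)) - inverse ((1 + z) + of_nat k))) =
       complex_of_real (2 * \<tau> / ((real (Suc k))\<^sup>2 + \<tau>\<^sup>2))"
      unfolding e1 N_def .
  qed
  finally show ?thesis by (subst (asm) sums_of_real_iff)
qed

text \<open>
The Laplace transform of the kernel \<open>v * (1 - v) / 2\<close> on the unit interval.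
\<close>
definition bump_laplace :: "real \<Rightarrow> real" where
  "bump_laplace t = ((1 + exp (-t)) / 2 - (1 - exp (-t)) / t) / t\<^sup>2"

lemma bump_laplace_has_integral:
  assumes t: "t > 0"
  shows "((\<lambda>v. v * (1 - v) / 2 * exp (- (v * t))) has_integral bump_laplace t) {0<..<1}"
proof -
  define A where "A = (\<lambda>v. - (v * (1 - v) / 2) * exp (- (v * t)) / t - (1 / 2 - v) * exp (- (v * t)) / t\<^sup>2
      + exp (- (v * t)) / t ^ 3)"
  have "((\<lambda>v. v * (1 - v) / 2 * exp (- (v * t))) has_integral (A 1 - A 0)) {0..1}"
  proof (rule fundamental_theorem_of_calculus)
    fix v :: real
    have e: "((\<lambda>v. exp (- (v * t))) has_real_derivative (- t * exp (- (v * t)))) (at v within {0..1})"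
      by (auto intro!: derivative_eq_intros)
    have w: "((\<lambda>v. - (v * (1 - v) / 2)) has_real_derivative (- (1 / 2 - v))) (at v within {0..1})"
      by (auto intro!: derivative_eq_intros simp: field_simps)
    have w': "((\<lambda>v. 1 / 2 - v) has_real_derivative (- 1)) (at v within {0..1})"
      by (auto intro!: derivative_eq_intros)
    have "(A has_real_derivative
      ((- (1 / 2 - v)) * exp (- (v * t)) + (- t * exp (- (v * t))) * (- (v * (1 - v) / 2))) / t
      - ((- 1) * exp (- (v * t)) + (- t * exp (- (v * t))) * (1 / 2 - v)) / t\<^sup>2
      + (- t * exp (- (v * t))) / t ^ 3) (at v within {0..1})"
      unfolding A_def
      by (rule DERIV_add[OF DERIV_diff[OF DERIV_cdivide[OF DERIV_mult[OF w e]]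
              DERIV_cdivide[OF DERIV_mult[OF w' e]]] DERIV_cdivide[OF e]])
    also have "((- (1 / 2 - v)) * exp (- (v * t)) + (- t * exp (- (v * t))) * (- (v * (1 - v) / 2))) / t
      - ((- 1) * exp (- (v * t)) + (- t * exp (- (v * t))) * (1 / 2 - v)) / t\<^sup>2
      + (- t * exp (- (v * t))) / t ^ 3 = v * (1 - v) / 2 * exp (- (v * t))"
    proof -
      have "((- p) * E + (- t * E) * (- w)) / t - ((- 1) * E + (- t * E) * p) / t\<^sup>2 + (- t * E)
          / t ^ 3 = w * E"
        for p E w :: real
        using t by (simp add: divide_simps power2_eq_square power3_eq_cube) (simp add: algebra_simps)
      thus ?thesis .
    qed
    finally show "(A has_vector_derivative v * (1 - v) / 2 * exp (- (v * t))) (at v within {0..1})"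
      by (simp add: has_real_derivative_iff_has_vector_derivative)
  qed auto
  also have "A 1 - A 0 = bump_laplace t"
    using t by (simp add: A_def bump_laplace_def field_simps power2_eq_square power3_eq_cube)
  finally show ?thesis by (simp add: has_integral_Icc_iff_Ioo)
qed

lemma bump_laplace_nonneg: "t > 0 \<Longrightarrow> bump_laplace t \<ge> 0"
  by (rule has_integral_nonneg[OF bump_laplace_has_integral]) auto

text \<open>
Dividing by \<open>1 - exp (-t)\<close> replaces the kernel on the unit interval by its periodic extension.  The
Laplace transform of the latter is \<open>(coth (t/2) / 2 - 1/t) / t\<^sup>2\<close>.
\<close>
lemma bump_laplace_partial_fractions:
  assumes t: "t > 0"
  shows "(\<lambda>n. 2 / (t * (t\<^sup>2 + (2 * pi * real (Suc n))\<^sup>2))) sums (bump_laplace t / (1 - exp (-t)))"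
proof -
  define \<tau> where "\<tau> = t / (2 * pi)"
  have \<tau>: "\<tau> > 0" using t by (simp add: \<tau>_def)
  have pt: "pi * \<tau> = t / 2" by (simp add: \<tau>_def)
  have "(\<lambda>n. 1 / (2 * pi * t\<^sup>2) * (2 * \<tau> / ((real (Suc n))\<^sup>2 + \<tau>\<^sup>2))) sums
      (1 / (2 * pi * t\<^sup>2) * (pi * cosh (pi * \<tau>) / sinh (pi * \<tau>) - 1 / \<tau>))"
    by (intro sums_mult coth_partial_fractions \<tau>)
  also have "(\<lambda>n. 1 / (2 * pi * t\<^sup>2) * (2 * \<tau> / ((real (Suc n))\<^sup>2 + \<tau>\<^sup>2))) =
      (\<lambda>n. 2 / (t * (t\<^sup>2 + (2 * pi * real (Suc n))\<^sup>2)))"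
  proof
    fix n
    have eq: "(real (Suc n))\<^sup>2 + \<tau>\<^sup>2 = (t\<^sup>2 + (2 * pi * real (Suc n))\<^sup>2) / (4 * pi\<^sup>2)"
      unfolding \<tau>_def by (simp add: field_simps power2_eq_square)
    have "t\<^sup>2 + (2 * pi * real (Suc n))\<^sup>2 > 0" using t by (simp add: add_pos_nonneg)
    thus "1 / (2 * pi * t\<^sup>2) * (2 * \<tau> / ((real (Suc n))\<^sup>2 + \<tau>\<^sup>2))
        = 2 / (t * (t\<^sup>2 + (2 * pi * real (Suc n))\<^sup>2))"
      unfolding eq using t by (simp add: \<tau>_def divide_simps power2_eq_square)
  qed
  also have "1 / (2 * pi * t\<^sup>2) * (pi * cosh (pi * \<tau>) / sinh (pi * \<tau>) - 1 / \<tau>)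
      = bump_laplace t / (1 - exp (-t))"
  proof -
    define h where "h = exp (- (t / 2))"
    have h: "h > 0" and e: "exp (-t) = h * h" and e1: "exp (-t) \<noteq> 1"
      using t by (simp_all add: h_def flip: exp_add)
    have "cosh (pi * \<tau>) = (1 + exp (-t)) / (2 * h)" "sinh (pi * \<tau>) = (1 - exp (-t)) / (2 * h)"
      unfolding e using h
      by (simp_all add: pt cosh_field_def sinh_field_def h_def[symmetric] exp_minus_inverse field_simps)
         (simp_all add: h_def flip: exp_add)
    hence "pi * cosh (pi * \<tau>) / sinh (pi * \<tau>) = pi * ((1 + exp (-t)) / (1 - exp (-t)))"
      using h by simp
    moreover have solve: "1 / (2 * p * t\<^sup>2) * (p * ((1 + x) / (1 - x)) - 1 / (t / (2 * p))) =
        ((1 + x) / 2 - (1 - x) / t) / t\<^sup>2 / (1 - x)" if "p > 0" "x \<noteq> 1" for p x :: real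
    proof -
      have "((1 + x) / 2 - (1 - x) / t) / t\<^sup>2 / (1 - x)
          = ((1 + x) / (1 - x) / 2 - (1 - x) / (1 - x) / t) / t\<^sup>2"
      proof -
        have "(A / 2 - B / t) / T / D = (A / D / 2 - B / D / t) / T" for A B T D :: real
          by (simp add: diff_divide_distrib mult_ac)
        thus ?thesis .
      qed
      also have "(1 - x) / (1 - x) = 1" using that by simp
      also have "((1 + x) / (1 - x) / 2 - 1 / t) / t\<^sup>2
          = 1 / (2 * p * t\<^sup>2) * (p * ((1 + x) / (1 - x)) - 1 / (t / (2 * p)))"
      proof -
        have "(r / 2 - 1 / t) / t\<^sup>2 = 1 / (2 * p * t\<^sup>2) * (p * r - 1 / (t / (2 * p)))" for r
          using that(1) t by (simp add: field_simps)
        thus ?thesis .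
      qed
      finally show ?thesis ..
    qed
    ultimately show ?thesis
      using e1 by (simp only: bump_laplace_def \<tau>_def pi_gt_zero not_False_eq_True)
  qed
  finally show ?thesis .
qed

section \<open>Mellin integrals\<close>

lemma nn_integral_Gamma_scaled:
  assumes z: "z > 0" and u: "u > 0"
  shows "(\<integral>\<^sup>+t. ennreal (indicator {0<..} t * (t powr (z - 1) * exp (- (u * t)))) \<partial>lborel) =
         ennreal (Gamma z * u powr (- z))"
proof -
  let ?f = "\<lambda>t. ennreal (indicator {0..} t * t powr (z - 1) / exp t)"
  let ?T = "\<integral>\<^sup>+t. ennreal (indicator {0<..} t * (t powr (z - 1) * exp (- (u * t)))) \<partial>lborel"
  have "ennreal (Gamma z) = integral\<^sup>N lborel ?f"
    by (rule Gamma_conv_nn_integral_real[OF z])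
  also have "\<dots> = ennreal u * (\<integral>\<^sup>+t. ?f (0 + u * t) \<partial>lborel)"
    using u by (subst nn_integral_real_affine[of ?f u 0]) auto
  also have "(\<integral>\<^sup>+t. ?f (0 + u * t) \<partial>lborel) =
      (\<integral>\<^sup>+t. ennreal (u powr (z - 1)) * ennreal (indicator {0<..} t * (t powr (z - 1) * exp (- (u
          * t)))) \<partial>lborel)"
    using u by (intro nn_integral_cong)
      (auto simp: indicator_def powr_mult exp_minus field_simps zero_le_mult_iff simp flip: ennreal_mult')
  also have "\<dots> = ennreal (u powr (z - 1)) * ?T"
    by (rule nn_integral_cmult) auto
  also have "ennreal u * (ennreal (u powr (z - 1)) * ?T) = ennreal (u powr z) * ?T"
    using u by (simp add: mult.assoc[symmetric] ennreal_mult'[symmetric] powr_mult_base)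
  finally have "ennreal (u powr (- z)) * ennreal (Gamma z)
      = ennreal (u powr (-z)) * (ennreal (u powr z) * ?T)"
    by simp
  also have "\<dots> = ?T"
    using u by (simp add: mult.assoc[symmetric] ennreal_mult'[symmetric] powr_add[symmetric])
  finally show ?thesis using z by (simp add: ennreal_mult'[symmetric] mult.commute Gamma_real_pos
      less_imp_le)
qed

text \<open>
Writing \<open>1 / (1 + w)\<close> as the Laplace integral of \<open>exp (- ((1 + w) * v))\<close> and integrating over \<open>w\<close>
first produces the two Gamma factors.
\<close>
lemma nn_integral_powr_over_linear:
  assumes a: "0 < a" "a < 1"
  shows "(\<integral>\<^sup>+w. ennreal (indicator {0<..} w * (w powr (a - 1) / (1 + w))) \<partial>lborel) =
         ennreal (Gamma a * Gamma (1 - a))"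
proof -
  let ?f = "\<lambda>w v. ennreal (indicator {0<..} w * w powr (a - 1) * (indicator {0<..} v * exp (- ((1
      + w) * v))))"
  have "(\<integral>\<^sup>+w. ennreal (indicator {0<..} w * (w powr (a - 1) / (1 + w))) \<partial>lborel) =
      (\<integral>\<^sup>+w. \<integral>\<^sup>+v. ?f w v \<partial>lborel \<partial>lborel)"
  proof (rule nn_integral_cong)
    fix w :: real
    show "ennreal (indicator {0<..} w * (w powr (a - 1) / (1 + w))) = (\<integral>\<^sup>+v. ?f w v \<partial>lborel)"
    proof (cases "w > 0")
      case True
      have "(\<integral>\<^sup>+v. ?f w v \<partial>lborel) = (\<integral>\<^sup>+v. ennreal (w powr (a - 1)) *
          ennreal (indicator {0<..} v * (v powr (1 - 1) * exp (- ((1 + w) * v)))) \<partial>lborel)"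
        using True by (intro nn_integral_cong) (auto simp: indicator_def simp flip: ennreal_mult')
      also have "\<dots> = ennreal (w powr (a - 1)) * ennreal (Gamma 1 * (1 + w) powr (-1))"
      proof -
        have "(\<integral>\<^sup>+v. ennreal (indicator {0<..} v * (v powr (1 - 1) * exp (- ((1 + w) * v)))) \<partial>lborel) =
            ennreal (Gamma 1 * (1 + w) powr (-1))"
          by (rule nn_integral_Gamma_scaled) (use True in auto)
        thus ?thesis by (subst nn_integral_cmult) auto
      qed
      also have "\<dots> = ennreal (w powr (a - 1) / (1 + w))"
        using True by (simp add: powr_minus divide_inverse flip: ennreal_mult')
      finally show ?thesis using True by simp
    qed simp
  qed
  also have "\<dots> = (\<integral>\<^sup>+v. \<integral>\<^sup>+w. ?f w v \<partial>lborel \<partial>lborel)"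
    by (rule lborel_pair.Fubini') measurable
  also have "\<dots> = (\<integral>\<^sup>+v. ennreal (Gamma a) * ennreal (indicator {0<..} v * (v powr ((1 - a) - 1)
      * exp (- (1 * v)))) \<partial>lborel)"
  proof (rule nn_integral_cong)
    fix v :: real
    show "(\<integral>\<^sup>+w. ?f w v \<partial>lborel) = ennreal (Gamma a) * ennreal (indicator {0<..} v * (v powr ((1
        - a) - 1) * exp (- (1 * v))))"
    proof (cases "v > 0")
      case True
      have "(\<integral>\<^sup>+w. ?f w v \<partial>lborel) = (\<integral>\<^sup>+w. ennreal (exp (-v)) *
         ennreal (indicator {0<..} w * (w powr (a - 1) * exp (- (v * w)))) \<partial>lborel)"
        using True by (intro nn_integral_cong)
          (auto simp: indicator_def algebra_simps exp_diff exp_minus field_simps simp flip: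
              ennreal_mult' exp_add)
      also have "\<dots> = ennreal (exp (-v)) * ennreal (Gamma a * v powr (-a))"
        using nn_integral_Gamma_scaled[OF a(1) True] by (subst nn_integral_cmult) auto
      also have "\<dots> = ennreal (Gamma a) * ennreal (indicator {0<..} v * (v powr ((1 - a) - 1)
          * exp (- (1 * v))))"
        using True a by (simp add: mult_ac Gamma_real_pos less_imp_le flip: ennreal_mult')
      finally show ?thesis .
    qed simp
  qed
  also have "\<dots> = ennreal (Gamma a) * ennreal (Gamma (1 - a) * 1 powr (- (1 - a)))"
  proof -
    have "(\<integral>\<^sup>+v. ennreal (indicator {0<..} v * (v powr ((1 - a) - 1) * exp (- (1 * v)))) \<partial>lborel) =
        ennreal (Gamma (1 - a) * 1 powr (- (1 - a)))"
      by (rule nn_integral_Gamma_scaled) (use a in auto)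
    thus ?thesis by (subst nn_integral_cmult) auto
  qed
  also have "\<dots> = ennreal (Gamma a * Gamma (1 - a))"
    using a by (simp add: Gamma_real_pos less_imp_le flip: ennreal_mult')
  finally show ?thesis .
qed

lemma Gamma_reflection_real:
  assumes "0 < a" "a < 1"
  shows "Gamma a * Gamma (1 - a) = pi / sin (pi * a)"
proof -
  have "complex_of_real (Gamma a * Gamma (1 - a)) = Gamma (of_real a) * Gamma (1 - of_real a)"
    using Gamma_complex_of_real[of a] Gamma_complex_of_real[of "1 - a"] by simp
  also have "\<dots> = of_real pi / sin (of_real pi * of_real a)" by (rule Gamma_reflection_complex)
  also have "\<dots> = of_real (pi / sin (pi * a))" using sin_of_real[of "pi * a", where ?'a = complex] by simp
  finally show ?thesis by (simp only: of_real_eq_iff)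
qed

text \<open>
The substitution \<open>w = (t / c)\<^sup>2\<close> reduces this to the previous integral with \<open>a = (s + 1) / 2\<close>, and the
reflection formula evaluates the product of Gamma values.
\<close>
lemma nn_integral_powr_over_quadratic:
  fixes s c :: real
  assumes s: "-1 < s" "s < 1" and c: "c > 0"
  shows "(\<integral>\<^sup>+t. ennreal (indicator {0<..} t * (t powr s / (t\<^sup>2 + c\<^sup>2))) \<partial>lborel) =
         ennreal (c powr (s - 1) * (pi / (2 * cos (pi * s / 2))))"
proof -
  define a where "a = (s + 1) / 2"
  have a: "0 < a" "a < 1" using s by (auto simp: a_def)
  define B where "B = Gamma a * Gamma (1 - a)"
  have B: "B \<ge> 0" unfolding B_def using a by (intro mult_nonneg_nonneg less_imp_le Gamma_real_pos) auto
  have B_eq: "B = pi / cos (pi * s / 2)"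
  proof -
    have "sin (pi * a) = sin (pi * s / 2 + pi / 2)" by (simp add: a_def field_simps)
    also have "\<dots> = cos (pi * s / 2)" by (simp add: sin_add)
    finally show ?thesis unfolding B_def using Gamma_reflection_real[OF a] by simp
  qed
  let ?f = "\<lambda>w. w powr (a - 1) / (1 + w)"
  have "((\<lambda>w. indicator {0<..} w * ?f w) has_integral B) UNIV"
    by (rule nn_integral_has_integral) (use nn_integral_powr_over_linear[OF a] B in \<open>auto simp:
        B_def indicator_def\<close>)
  also have "(\<lambda>w. indicator {0<..} w * ?f w) = (\<lambda>w. if w \<in> {0<..} then ?f w else 0)"
    by (auto simp: fun_eq_iff)
  finally have f: "(?f has_integral B) {0<..}" by (subst (asm) has_integral_restrict_UNIV)
  let ?g = "\<lambda>t. (t / c)\<^sup>2" and ?g' = "\<lambda>t. 2 * t / c\<^sup>2"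
  have img: "?g ` {0<..} = {0<..}"
  proof
    show "{0<..} \<subseteq> ?g ` {0<..}"
    proof
      fix w :: real assume "w \<in> {0<..}"
      thus "w \<in> ?g ` {0<..}" using c by (intro image_eqI[of _ _ "c * sqrt w"]) auto
    qed
  qed (use c in auto)
  have "(\<lambda>t. \<bar>?g' t\<bar> * ?f (?g t)) absolutely_integrable_on {0<..} \<and>
        integral {0<..} (\<lambda>t. \<bar>?g' t\<bar> * ?f (?g t)) = B \<longleftrightarrow>
        ?f absolutely_integrable_on (?g ` {0<..}) \<and> integral (?g ` {0<..}) ?f = B"
  proof (rule has_absolute_integral_change_of_variables_1')
    show "(?g has_real_derivative ?g' t) (at t within {0<..})" for t
      using c by (auto intro!: derivative_eq_intros simp: power2_eq_square)
    show "inj_on ?g {0<..}"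
      using c by (intro inj_onI) (simp add: power2_eq_iff_nonneg)
  qed auto
  moreover have "?f absolutely_integrable_on (?g ` {0<..}) \<and> integral (?g ` {0<..}) ?f = B"
    unfolding img using f by (auto intro!: nonnegative_absolutely_integrable_1 integral_unique)
  ultimately have G: "(\<lambda>t. \<bar>?g' t\<bar> * ?f (?g t)) absolutely_integrable_on {0<..}"
        "integral {0<..} (\<lambda>t. \<bar>?g' t\<bar> * ?f (?g t)) = B"
            by (rule iffD2[THEN conjunct1], rule iffD2[THEN conjunct2])
  have "((\<lambda>t. \<bar>?g' t\<bar> * ?f (?g t)) has_integral B) {0<..}"
    using integrable_integral[OF set_lebesgue_integral_eq_integral(1)[OF G(1)]] unfolding G(2) .
  hence "((\<lambda>t. c powr (s - 1) / 2 * (\<bar>?g' t\<bar> * ?f (?g t))) has_integral (c powr (s - 1) / 2 * B)) {0<..}"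
    by (rule has_integral_mult_right)
  hence "((\<lambda>t. t powr s / (t\<^sup>2 + c\<^sup>2)) has_integral (c powr (s - 1) / 2 * B)) {0<..}"
  proof (rule has_integral_eq[rotated])
    fix t :: real assume "t \<in> {0<..}"
    hence t: "t > 0" by simp
    have "?g t = (t / c) powr 2" using t c by simp
    hence "?g t powr (a - 1) = (t / c) powr (2 * (a - 1))" by (simp only: powr_powr)
    also have "2 * (a - 1) = s - 1" by (simp add: a_def)
    also have "(t / c) powr (s - 1) = t powr s / t / c powr (s - 1)"
      using t c by (simp add: powr_divide powr_diff)
    finally have p: "?g t powr (a - 1) = t powr s / t / c powr (s - 1)" .
    have q: "1 + ?g t = (t\<^sup>2 + c\<^sup>2) / c\<^sup>2" using c by (simp add: field_simps)
    have "t\<^sup>2 + c\<^sup>2 > 0" using t by (simp add: add_pos_nonneg)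
    thus "c powr (s - 1) / 2 * (\<bar>?g' t\<bar> * ?f (?g t)) = t powr s / (t\<^sup>2 + c\<^sup>2)"
      unfolding p q using t c by (simp add: abs_of_pos)
  qed
  hence "(\<integral>\<^sup>+t. ennreal (indicator {0<..} t * (t powr s / (t\<^sup>2 + c\<^sup>2))) \<partial>lborel)
      = ennreal (c powr (s - 1) / 2 * B)"
    by (intro nn_integral_has_integral_lebesgue) auto
  thus ?thesis by (simp add: B_eq mult_ac)
qed

section \<open>The functional equation\<close>

text \<open>
The real form of \<open>trapezoid_error n s\<close>.  For \<open>-1 < s < 0\<close> it is also meaningful at \<open>n = 0\<close>, where the
power is unbounded near \<open>v = 0\<close> but the factor \<open>v\<close> makes it integrable.
\<close>
definition bump_moment :: "real \<Rightarrow> nat \<Rightarrow> real" where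
  "bump_moment s n = integral {0<..<1} (\<lambda>v. v * (1 - v) / 2 * (real n + v) powr (- s - 2))"

text \<open>
The integrand is a difference of two powers of \<open>v\<close>.  The value is what makes the elementary part \<open>1/2 + 1/(s-1)\<close> of zeta disappear from the
trapezoid series when the interval from \<open>0\<close> to \<open>1\<close> is included.
\<close>
lemma bump_moment_0:
  assumes s: "-1 < s" "s < 0"
  shows "((\<lambda>v. v * (1 - v) / 2 * (real 0 + v) powr (- s - 2))
      has_integral (- 1 / (2 * s * (1 - s)))) {0<..<1}"
proof -
  have "((\<lambda>v::real. 1 / 2 * (v powr (- s - 1) - v powr (- s))) has_integral
      (1 / 2 * (1 powr (- s - 1 + 1) / (- s - 1 + 1) - 1 powr (- s + 1) / (- s + 1)))) {0..1}"
    using s by (intro has_integral_mult_right has_integral_diff has_integral_powr_from_0) auto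
  also have "1 / 2 * (1 powr (- s - 1 + 1) / (- s - 1 + 1) - 1 powr (- s + 1) / (- s + 1))
      = - 1 / (2 * s * (1 - s))"
    using s by (simp add: divide_simps)
  finally have "((\<lambda>v::real. 1 / 2 * (v powr (- s - 1) - v powr (- s)))
      has_integral (- 1 / (2 * s * (1 - s)))) {0<..<1}"
    by (simp only: has_integral_Icc_iff_Ioo)
  thus ?thesis
  proof (rule has_integral_eq[rotated])
    fix v :: real assume v: "v \<in> {0<..<1}"
    have e: "1 + (- s - 2) = - s - 1" "1 + (- s - 1) = - s" by simp_all
    have "v powr (- s - 1) = v * v powr (- s - 2)" "v powr (- s) = v * v powr (- s - 1)"
      using v powr_mult_base[of v "- s - 2", unfolded e] powr_mult_base[of v "- s - 1", unfolded e]
          by (metis greaterThanLessThan_iff less_imp_le)+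
    thus "1 / 2 * (v powr (- s - 1) - v powr (- s)) = v * (1 - v) / 2 * (real 0 + v) powr (- s - 2)"
      by (simp add: algebra_simps)
  qed
qed

lemma bump_moment_Suc:
  shows "((\<lambda>v. v * (1 - v) / 2 * (real (Suc n) + v) powr (- s - 2))
      has_integral bump_moment s (Suc n)) {0<..<1}"
    and "trapezoid_error (real (Suc n)) (of_real s) = of_real (bump_moment s (Suc n))"
proof -
  have "(\<lambda>v. v * (1 - v) / 2 * (real (Suc n) + v) powr (- s - 2)) integrable_on {0..1}"
    by (rule integrable_continuous_interval) (auto intro!: continuous_intros)
  hence "(\<lambda>v. v * (1 - v) / 2 * (real (Suc n) + v) powr (- s - 2)) integrable_on {0<..<1}"
    by (simp add: integrable_on_Icc_iff_Ioo)
  thus I: "((\<lambda>v. v * (1 - v) / 2 * (real (Suc n) + v) powr (- s - 2))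
      has_integral bump_moment s (Suc n)) {0<..<1}"
    unfolding bump_moment_def by (rule integrable_integral)
  hence "((\<lambda>v. complex_of_real (v * (1 - v) / 2 * (real (Suc n) + v) powr (- s - 2))) has_integral
      of_real (bump_moment s (Suc n))) {0..1}"
    by (intro has_integral_of_real) (simp only: has_integral_Icc_iff_Ioo)
  hence "((\<lambda>v. of_real (v * (1 - v) / 2) * exp (- (of_real s + 2) * of_real (ln (real (Suc n)
      + v)))) has_integral
      complex_of_real (bump_moment s (Suc n))) {0..1}"
  proof (rule has_integral_eq[rotated])
    fix v :: real assume "v \<in> {0..1}"
    hence "(real (Suc n) + v) powr (- s - 2) = exp (- (s + 2) * ln (real (Suc n) + v))"
      by (simp add: powr_def algebra_simps)
    thus "complex_of_real (v * (1 - v) / 2 * (real (Suc n) + v) powr (- s - 2)) =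
       of_real (v * (1 - v) / 2) * exp (- (of_real s + 2) * of_real (ln (real (Suc n) + v)))"
      by (simp only: of_real_mult exp_of_real[symmetric]) simp
  qed
  thus "trapezoid_error (real (Suc n)) (of_real s) = of_real (bump_moment s (Suc n))"
    unfolding trapezoid_error_def by (rule integral_unique)
qed

lemma bump_moment_has_integral:
  assumes s: "-1 < s" "s < 0"
  shows "((\<lambda>v. v * (1 - v) / 2 * (real n + v) powr (- s - 2)) has_integral bump_moment s n) {0<..<1}"
proof (cases n)
  case 0
  have "bump_moment s 0 = - 1 / (2 * s * (1 - s))"
    unfolding bump_moment_def by (rule integral_unique[OF bump_moment_0[OF s]])
  thus ?thesis using bump_moment_0[OF s] 0 by (simp only:)
next
  case (Suc k)
  thus ?thesis using bump_moment_Suc(1)[of k s] by simp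
qed

lemma bump_moment_nonneg:
  assumes "-1 < s" "s < 0"
  shows "bump_moment s n \<ge> 0"
  by (rule has_integral_nonneg[OF bump_moment_has_integral[OF assms]]) auto

text \<open>
\<open>\<Gamma>(s+2) * (n + v) powr (-s-2)\<close> is the integral of \<open>t powr (s+1) * exp (- ((n + v) * t))\<close>; the integration
over \<open>v\<close> is then carried out first.
\<close>
lemma bump_moment_Gamma:
  assumes s: "-1 < s" "s < 0"
  shows "ennreal (Gamma (s + 2) * bump_moment s n) =
    (\<integral>\<^sup>+t. ennreal (indicator {0<..} t * (t powr (s + 1) * bump_laplace t * exp (- t) ^ n)) \<partial>lborel)"
proof -
  let ?w = "\<lambda>v. indicator {0<..<1} v * (v * (1 - v) / 2) :: real"
  let ?f = "\<lambda>v t. ennreal (?w v * (indicator {0<..} t * (t powr (s + 1) * exp (- ((real n + v) * t)))))"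
  have G: "Gamma (s + 2) > 0" using s by (intro Gamma_real_pos) auto
  have w: "?w v \<ge> 0" for v by (auto simp: indicator_def)
  have "ennreal (Gamma (s + 2) * bump_moment s n) =
      (\<integral>\<^sup>+v. ennreal (indicator {0<..<1} v * (Gamma (s + 2) * (v * (1 - v) / 2 * (real n
          + v) powr (- s - 2)))) \<partial>lborel)"
  proof (rule nn_integral_has_integral_lebesgue[symmetric])
    show "((\<lambda>v. Gamma (s + 2) * (v * (1 - v) / 2 * (real n + v) powr (- s - 2))) has_integral
        (Gamma (s + 2) * bump_moment s n)) {0<..<1}"
      by (rule has_integral_mult_right, rule bump_moment_has_integral[OF s])
  qed (use G in auto)
  also have "\<dots> = (\<integral>\<^sup>+v. \<integral>\<^sup>+t. ?f v t \<partial>lborel \<partial>lborel)"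
  proof (rule nn_integral_cong)
    fix v :: real
    show "ennreal (indicator {0<..<1} v * (Gamma (s + 2) * (v * (1 - v) / 2 * (real n + v) powr (- s
        - 2)))) =
      (\<integral>\<^sup>+t. ?f v t \<partial>lborel)"
    proof (cases "v \<in> {0<..<1}")
      case True
      have "(\<integral>\<^sup>+t. ?f v t \<partial>lborel) = (\<integral>\<^sup>+t. ennreal (?w v) *
          ennreal (indicator {0<..} t * (t powr ((s + 2) - 1) * exp (- ((real n + v) * t)))) \<partial>lborel)"
      proof -
        have e: "(s + 2) - 1 = s + 1" by simp
        show ?thesis unfolding e by (intro nn_integral_cong ennreal_mult' w)
      qed
      also have "\<dots> = ennreal (?w v) * (\<integral>\<^sup>+t. ennreal (indicator {0<..} t * (t powr ((s + 2) - 1)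
          * exp (- ((real n + v) * t)))) \<partial>lborel)"
        by (rule nn_integral_cmult) measurable
      also have "(\<integral>\<^sup>+t. ennreal (indicator {0<..} t * (t powr ((s + 2) - 1) * exp (- ((real n + v)
          * t)))) \<partial>lborel) =
          ennreal (Gamma (s + 2) * (real n + v) powr (- (s + 2)))"
        by (rule nn_integral_Gamma_scaled) (use s True in auto)
      also have "ennreal (?w v) * ennreal (Gamma (s + 2) * (real n + v) powr (- (s + 2))) =
          ennreal (?w v * (Gamma (s + 2) * (real n + v) powr (- (s + 2))))"
        using w[of v] by (rule ennreal_mult'[symmetric])
      also have "?w v * (Gamma (s + 2) * (real n + v) powr (- (s + 2))) =
          indicator {0<..<1} v * (Gamma (s + 2) * (v * (1 - v) / 2 * (real n + v) powr (- s - 2)))"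
        by simp
      finally show ?thesis ..
    qed simp
  qed
  also have "\<dots> = (\<integral>\<^sup>+t. \<integral>\<^sup>+v. ?f v t \<partial>lborel \<partial>lborel)"
    by (rule lborel_pair.Fubini') measurable
  also have "\<dots> = (\<integral>\<^sup>+t. ennreal (indicator {0<..} t * (t powr (s + 1) * bump_laplace t
      * exp (- t) ^ n)) \<partial>lborel)"
  proof (rule nn_integral_cong)
    fix t :: real
    show "(\<integral>\<^sup>+v. ?f v t \<partial>lborel) = ennreal (indicator {0<..} t * (t powr (s + 1) * bump_laplace t
        * exp (- t) ^ n))"
    proof (cases "t > 0")
      case True
      have "((\<lambda>v. (t powr (s + 1) * exp (- t) ^ n) * (v * (1 - v) / 2 * exp (- (v * t)))) has_integral
          ((t powr (s + 1) * exp (- t) ^ n) * bump_laplace t)) {0<..<1}"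
        by (intro has_integral_mult_right bump_laplace_has_integral True)
      hence "(\<integral>\<^sup>+v. ennreal (indicator {0<..<1} v * ((t powr (s + 1) * exp (- t) ^ n) * (v * (1 - v)
          / 2 * exp (- (v * t))))) \<partial>lborel) =
          ennreal ((t powr (s + 1) * exp (- t) ^ n) * bump_laplace t)"
        by (intro nn_integral_has_integral_lebesgue) auto
      moreover have "(\<integral>\<^sup>+v. ?f v t \<partial>lborel) =
         (\<integral>\<^sup>+v. ennreal (indicator {0<..<1} v * ((t powr (s + 1) * exp (- t) ^ n) * (v * (1 - v) / 2
             * exp (- (v * t))))) \<partial>lborel)"
      proof (rule nn_integral_cong)
        fix v :: real
        have "exp (- ((real n + v) * t)) = exp (- t) ^ n * exp (- (v * t))"
          by (simp add: exp_of_nat_mult[symmetric] algebra_simps flip: exp_add)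
        thus "?f v t = ennreal (indicator {0<..<1} v * ((t powr (s + 1) * exp (- t) ^ n) * (v * (1
            - v) / 2 * exp (- (v * t)))))"
          using True by (simp add: mult_ac)
      qed
      ultimately show ?thesis using True by (simp add: mult_ac)
    qed simp
  qed
  finally show ?thesis .
qed

text \<open>
All terms are nonnegative, so the sum may be taken inside the integral, evaluated there as a
geometric series, expanded into partial fractions instead, and taken out again.
\<close>
lemma suminf_bump_moment_Gamma:
  assumes s: "-1 < s" "s < 0"
  shows "(\<Sum>n. ennreal (Gamma (s + 2) * bump_moment s n)) =
         (\<Sum>n. ennreal (2 * ((2 * pi * real (Suc n)) powr (s - 1) * (pi / (2 * cos (pi * s / 2))))))"
proof -
  let ?L = "\<lambda>n t. ennreal (indicator {0<..} t * (t powr (s + 1) * bump_laplace t * exp (- t) ^ n))"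
  let ?R = "\<lambda>n t. ennreal 2 * ennreal (indicator {0<..} t * (t powr s / (t\<^sup>2 + (2 * pi
      * real (Suc n))\<^sup>2)))"
  have [measurable]: "bump_laplace \<in> borel_measurable borel" unfolding bump_laplace_def by measurable
  have "(\<Sum>n. ennreal (Gamma (s + 2) * bump_moment s n)) = (\<Sum>n. \<integral>\<^sup>+t. ?L n t \<partial>lborel)"
    by (simp only: bump_moment_Gamma[OF s])
  also have "\<dots> = (\<integral>\<^sup>+t. (\<Sum>n. ?L n t) \<partial>lborel)"
    by (rule nn_integral_suminf[symmetric]) measurable
  also have "\<dots> = (\<integral>\<^sup>+t. (\<Sum>n. ?R n t) \<partial>lborel)"
  proof (rule nn_integral_cong)
    fix t :: real
    show "(\<Sum>n. ?L n t) = (\<Sum>n. ?R n t)"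
    proof (cases "t > 0")
      case True
      let ?V = "t powr (s + 1) * (bump_laplace t / (1 - exp (- t)))"
      have "(\<lambda>n. t powr (s + 1) * bump_laplace t * exp (- t) ^ n) sums
          (t powr (s + 1) * bump_laplace t * (1 / (1 - exp (- t))))"
        by (intro sums_mult geometric_sums) (use True in auto)
      hence 1: "(\<lambda>n. t powr (s + 1) * bump_laplace t * exp (- t) ^ n) sums ?V" by simp
      have "(\<Sum>n. ?L n t) = ennreal ?V"
        using True bump_laplace_nonneg[OF True] sums_unique[OF 1] sums_summable[OF 1]
        by (subst suminf_ennreal2) auto
      moreover have 2: "(\<lambda>n. t powr (s + 1) * (2 / (t * (t\<^sup>2 + (2 * pi * real (Suc n))\<^sup>2)))) sums ?V"
        by (intro sums_mult bump_laplace_partial_fractions True)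
      have "?R n t = ennreal (t powr (s + 1) * (2 / (t * (t\<^sup>2 + (2 * pi * real (Suc n))\<^sup>2))))" for n
      proof -
        have "t powr (s + 1) = t * t powr s" using True powr_mult_base[of t s] by (simp add: add.commute)
        hence "2 * (indicator {0<..} t * (t powr s / (t\<^sup>2 + (2 * pi * real (Suc n))\<^sup>2))) =
            t powr (s + 1) * (2 / (t * (t\<^sup>2 + (2 * pi * real (Suc n))\<^sup>2)))"
          using True by simp
        thus ?thesis by (metis ennreal_mult' zero_le_numeral)
      qed
      hence "(\<Sum>n. ?R n t) = ennreal ?V"
        using True sums_unique[OF 2] sums_summable[OF 2]
        by (simp only:) (subst suminf_ennreal2, auto intro!: mult_nonneg_nonneg divide_nonneg_nonneg)
      ultimately show ?thesis by simp
    qed simp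
  qed
  also have "\<dots> = (\<Sum>n. \<integral>\<^sup>+t. ?R n t \<partial>lborel)"
    by (rule nn_integral_suminf) measurable
  also have "\<dots> = (\<Sum>n. ennreal (2 * ((2 * pi * real (Suc n)) powr (s - 1) * (pi / (2 * cos (pi * s
      / 2))))))"
  proof (rule suminf_cong)
    fix n
    have "(\<integral>\<^sup>+t. ?R n t \<partial>lborel) = ennreal 2 * (\<integral>\<^sup>+t. ennreal (indicator {0<..} t * (t powr s / (t\<^sup>2
        + (2 * pi * real (Suc n))\<^sup>2))) \<partial>lborel)"
      by (rule nn_integral_cmult) measurable
    also have "\<dots> = ennreal 2 * ennreal ((2 * pi * real (Suc n)) powr (s - 1) * (pi / (2 * cos (pi
        * s / 2))))"
      by (subst nn_integral_powr_over_quadratic) (use s in auto)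
    also have "\<dots> = ennreal (2 * ((2 * pi * real (Suc n)) powr (s - 1) * (pi / (2 * cos (pi * s / 2)))))"
      by (rule ennreal_mult'[symmetric]) simp
    finally show "(\<integral>\<^sup>+t. ?R n t \<partial>lborel)
        = ennreal (2 * ((2 * pi * real (Suc n)) powr (s - 1) * (pi / (2 * cos (pi * s / 2)))))" .
  qed
  finally show ?thesis .
qed

text \<open>
By \<open>suminf_bump_moment_Gamma\<close> the moments sum to a multiple of \<open>\<Sum>n. (n+1) powr (s-1)\<close>, which is
\<open>\<zeta>(1 - s)\<close>.  By the trapezoid series they also sum to \<open>\<zeta>(s) / (s * (s + 1))\<close>.
\<close>
lemma functional_equation_real:
  assumes s: "-1 < s" "s < 0"
  shows "2 * cos (of_real pi * of_real s / 2) * regular_zeta (of_real s) =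
     (1 - of_real s) * rGamma (of_real s + 1) * of_real (2 * pi) powr (of_real s) * regular_zeta (1
         - of_real s)"
proof -
  define G where "G = Gamma (s + 2)"
  define c where "c = cos (pi * s / 2)"
  define Z where "Z = (\<Sum>n. real (Suc n) powr (s - 1))"
  define P where "P = (2 * pi) powr s"
  have G: "G > 0" unfolding G_def using s by (intro Gamma_real_pos) auto
  have "pi * s > - pi" "pi * s < 0"
    using mult_strict_left_mono[of "-1" s pi] mult_pos_neg[of pi s] s by auto
  hence "- (pi / 2) < pi * s / 2" "pi * s / 2 < pi / 2" using pi_gt_zero by linarith+
  hence c: "c > 0" unfolding c_def by (rule cos_gt_zero_pi)
  have Z_sums: "(\<lambda>n. real (Suc n) powr (s - 1)) sums Z"
    unfolding Z_def using s by (intro summable_sums, subst summable_Suc_iff) (simp add: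
        summable_real_powr_iff)
  let ?R = "\<lambda>n. 2 * ((2 * pi * real (Suc n)) powr (s - 1) * (pi / (2 * c)))"
  have P: "(2 * pi) powr (s - 1) * (2 * pi) = P"
    using powr_mult_base[of "2 * pi" "s - 1"] by (simp add: P_def mult.commute)
  have "(\<lambda>n. (P / (2 * c)) * real (Suc n) powr (s - 1)) sums (P / (2 * c) * Z)"
    by (intro sums_mult Z_sums)
  also have "(\<lambda>n. (P / (2 * c)) * real (Suc n) powr (s - 1)) = ?R"
  proof
    fix n show "(P / (2 * c)) * real (Suc n) powr (s - 1) = ?R n"
      unfolding P[symmetric] powr_mult using c by (simp add: mult_ac)
  qed
  finally have R: "?R sums (P / (2 * c) * Z)" .
  have R0: "?R n \<ge> 0" for n using c by (intro mult_nonneg_nonneg) auto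
  have M0: "G * bump_moment s n \<ge> 0" for n
    using G bump_moment_nonneg[OF s] by (intro mult_nonneg_nonneg) auto
  have "(\<Sum>n. ennreal (G * bump_moment s n)) = (\<Sum>n. ennreal (?R n))"
    using suminf_bump_moment_Gamma[OF s] by (simp only: G_def c_def)
  also have "\<dots> = ennreal (\<Sum>n. ?R n)"
    by (rule suminf_ennreal2[OF R0 sums_summable[OF R]])
  also have "(\<Sum>n. ?R n) = P / (2 * c) * Z" using R by (rule sums_unique[symmetric])
  finally have E: "(\<Sum>n. ennreal (G * bump_moment s n)) = ennreal (P / (2 * c) * Z)" .
  have sm: "summable (\<lambda>n. G * bump_moment s n)"
    by (rule summable_suminf_not_top[OF M0]) (simp add: E)
  have "ennreal (\<Sum>n. G * bump_moment s n) = ennreal (P / (2 * c) * Z)"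
    using suminf_ennreal2[OF M0 sm] E by simp
  moreover have "(\<Sum>n. G * bump_moment s n) \<ge> 0" by (rule suminf_nonneg[OF sm M0])
  moreover have "P / (2 * c) * Z \<ge> 0"
    using c unfolding Z_def by (intro mult_nonneg_nonneg suminf_nonneg sums_summable[OF Z_sums])
        (auto simp: P_def)
  ultimately have "(\<Sum>n. G * bump_moment s n) = P / (2 * c) * Z" by (simp add: ennreal_inj)
  hence "(\<lambda>n. G * bump_moment s n) sums (P / (2 * c) * Z)" using summable_sums[OF sm] by simp
  hence "(\<lambda>n. G * bump_moment s n / G) sums (P / (2 * c) * Z / G)" by (rule sums_divide)
  hence M: "bump_moment s sums (P / (2 * c) * Z / G)" using G by simp
  define r where "r = P / (2 * c) * Z / G"
  \<comment> \<open>The moment with index \<open>0\<close> is not part of the trapezoid series; it cancels the elementary term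
    \<open>(s + 1) / 2\<close> there.\<close>
  have m0: "bump_moment s 0 = - 1 / (2 * s * (1 - s))"
    unfolding bump_moment_def by (rule integral_unique[OF bump_moment_0[OF s]])
  have M': "(\<lambda>n. bump_moment s (Suc n)) sums (r - bump_moment s 0)"
    using M unfolding r_def by (subst sums_Suc_iff) simp
  obtain C where C: "\<And>z. Re z > -1 \<Longrightarrow> (\<lambda>n. z * (z + 1) * trapezoid_error (real (Suc n)) z) sums C z"
    "\<And>z. Re z > -1 \<Longrightarrow> regular_zeta z = (z + 1) / 2 + (z - 1) * C z"
    by (rule regular_zeta_trapezoid) blast
  have "(\<lambda>n. complex_of_real (s * (s + 1) * bump_moment s (Suc n)))
      sums of_real (s * (s + 1) * (r - bump_moment s 0))"
    by (intro sums_of_real sums_mult M')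
  moreover have "(\<lambda>n. complex_of_real (s * (s + 1) * bump_moment s (Suc n))) =
      (\<lambda>n. of_real s * (of_real s + 1) * trapezoid_error (real (Suc n)) (of_real s))"
    by (simp only: bump_moment_Suc(2) of_real_mult of_real_add of_real_1)
  ultimately have "C (of_real s) = of_real (s * (s + 1) * (r - bump_moment s 0))"
    using C(1)[of "of_real s"] s by (auto intro: sums_unique2)
  hence "regular_zeta (of_real s)
      = of_real ((s + 1) / 2 + (s - 1) * (s * (s + 1) * (r - bump_moment s 0)))"
    using C(2)[of "of_real s"] s by simp
  also have "(s + 1) / 2 + (s - 1) * (s * (s + 1) * (r - bump_moment s 0)) = (s - 1) * s * (s + 1) * r"
  proof -
    have "(s - 1) * s * (s + 1) * bump_moment s 0 = (s + 1) / 2"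
      unfolding m0 using s by (simp add: divide_simps) (simp add: algebra_simps)
    moreover have "(s + 1) / 2 + (s - 1) * (s * (s + 1) * (r - b)) =
        (s - 1) * s * (s + 1) * r + ((s + 1) / 2 - (s - 1) * s * (s + 1) * b)" for b
      by (simp add: algebra_simps)
    ultimately show ?thesis by simp
  qed
  finally have L: "regular_zeta (of_real s) = of_real ((s - 1) * s * (s + 1) * r)" .
  have D: "dirichlet_sum 1 (1 - of_real s) = of_real Z"
  proof -
    have "(\<lambda>n. complex_of_real (real n + 1) powr (- (1 - of_real s)))
        sums dirichlet_sum 1 (1 - of_real s)"
      by (rule dirichlet_sums) (use s in auto)
    also have "(\<lambda>n. complex_of_real (real n + 1) powr (- (1 - of_real s)))
        = (\<lambda>n. of_real (real (Suc n) powr (s - 1)))"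
    proof
      fix n
      have "complex_of_real (real n + 1) powr (- (1 - of_real s))
          = of_real (real (Suc n)) powr (of_real (s - 1))"
        by (simp add: add.commute)
      also have "\<dots> = of_real (real (Suc n) powr (s - 1))" by (rule powr_of_real) auto
      finally show "complex_of_real (real n + 1) powr (- (1 - of_real s))
          = of_real (real (Suc n) powr (s - 1))" .
    qed
    finally show ?thesis using sums_of_real[OF Z_sums] by (rule sums_unique2)
  qed
  have Rz: "regular_zeta (1 - of_real s) = of_real (- s * Z)"
    using regular_zeta_eq_dirichlet[of "1 - of_real s"] s by (simp add: D)
  have g1: "rGamma (complex_of_real s + 1) = of_real ((s + 1) / G)"
  proof -
    have "rGamma (s + 1) = (s + 1) * rGamma (s + 2)"
      using rGamma_plus1[of "s + 1"] by (simp add: add.assoc)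
    also have "\<dots> = (s + 1) / G" by (simp add: G_def Gamma_def divide_inverse)
    finally have "complex_of_real (rGamma (s + 1)) = of_real ((s + 1) / G)" by simp
    thus ?thesis by (simp add: rGamma_complex_of_real[symmetric])
  qed
  have p1: "complex_of_real (2 * pi) powr (of_real s) = of_real P"
    unfolding P_def by (rule powr_of_real) auto
  have c1: "cos (complex_of_real pi * of_real s / 2) = of_real c"
    using cos_of_real[of "pi * s / 2", where ?'a = complex] by (simp add: c_def)
  have "2 * c * ((s - 1) * s * (s + 1) * r) = (1 - s) * ((s + 1) / G) * P * (- s * Z)"
    unfolding r_def using c G by (simp add: field_simps)
  hence "complex_of_real (2 * c * ((s - 1) * s * (s + 1) * r))
      = of_real ((1 - s) * ((s + 1) / G) * P * (- s * Z))"
    by (simp only:)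
  thus ?thesis unfolding L Rz g1 p1 c1 by (simp only: of_real_mult of_real_diff of_real_1 of_real_numeral)
qed

text \<open>
Both sides are entire and agree on the real interval from \<open>-1\<close> to \<open>0\<close>.
\<close>
lemma functional_equation:
  "2 * cos (of_real pi * s / 2) * regular_zeta s =
     (1 - s) * rGamma (s + 1) * of_real (2 * pi) powr s * regular_zeta (1 - s)"
proof -
  define f where "f = (\<lambda>s. 2 * cos (of_real pi * s / 2) * regular_zeta s -
     (1 - s) * rGamma (s + 1) * of_real (2 * pi) powr s * regular_zeta (1 - s))"
  have refl: "(regular_zeta \<circ> (\<lambda>s. 1 - s)) holomorphic_on UNIV"
    by (intro holomorphic_on_compose_gen[OF _ holomorphic_regular_zeta] holomorphic_intros) auto
  have "(rGamma \<circ> (\<lambda>s. s + 1)) holomorphic_on UNIV"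
    by (intro holomorphic_on_compose_gen[OF _ holomorphic_rGamma] holomorphic_intros) auto
  hence hol: "f holomorphic_on UNIV" using refl unfolding f_def o_def
    by (intro holomorphic_intros holomorphic_regular_zeta) auto
  have "f s = 0"
  proof (rule analytic_continuation[OF hol, of "of_real ` {-1<..<0}" "of_real (-1/2)"])
    \<comment> \<open>Any point of the interval would do as an accumulation point.\<close>
    show "complex_of_real (-1/2) islimpt of_real ` {-1<..<0}"
      unfolding islimpt_sequential
    proof (intro exI conjI allI)
      fix n
      show "complex_of_real (-1/2 + 1 / real (n + 3)) \<in> of_real ` {-1<..<0} - {of_real (-1/2)}"
      proof -
        have "1 / real (n + 3) \<le> 1 / 3" by (rule divide_left_mono) auto
        moreover have "1 / real (n + 3) > 0" by simp
        ultimately have "-1/2 + 1 / real (n + 3) \<in> {-1<..<0}" "-1/2 + 1 / real (n + 3) \<noteq> -1/2"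
          unfolding greaterThanLessThan_iff by linarith+
        thus ?thesis by (metis DiffI empty_iff imageI insertE of_real_eq_iff)
      qed
    next
      have "(\<lambda>n. complex_of_real (-1/2 + 1 / real (n + 3))) \<longlonglongrightarrow> of_real (-1/2 + 0)"
        by (intro tendsto_intros LIMSEQ_ignore_initial_segment[OF lim_1_over_n])
      thus "(\<lambda>n. complex_of_real (-1/2 + 1 / real (n + 3))) \<longlonglongrightarrow> of_real (-1/2)" by simp
    qed
    show "f z = 0" if "z \<in> complex_of_real ` {-1<..<0}" for z
      using that functional_equation_real by (auto simp: f_def)
  qed auto
  thus ?thesis by (simp add: f_def)
qed

section \<open>Values and derivatives at zero and at the negative even integers\<close>

lemma regular_zeta_1 [simp]: "regular_zeta 1 = 1"
  by (simp add: regular_zeta_def)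

text \<open>
At \<open>s = 0\<close> the functional equation reads \<open>2 * regular_zeta 0 = regular_zeta 1\<close>.
\<close>
lemma regular_zeta_0: "regular_zeta 0 = 1 / 2"
  using functional_equation[of 0] by (simp add: field_simps)

lemma deriv_riemann_zeta_eq:
  assumes "(regular_zeta has_field_derivative D) (at s)" "s \<noteq> 1"
  shows "deriv riemann_zeta s = (D * (s - 1) - regular_zeta s) / (s - 1)\<^sup>2"
proof -
  have "((\<lambda>s. regular_zeta s / (s - 1)) has_field_derivative
      (D * (s - 1) - regular_zeta s * 1) / ((s - 1) * (s - 1))) (at s)"
    by (rule DERIV_divide[OF assms(1)]) (use assms(2) in \<open>auto intro!: derivative_eq_intros\<close>)
  hence "(riemann_zeta has_field_derivative (D * (s - 1) - regular_zeta s * 1) / ((s - 1) * (s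
      - 1))) (at s)"
    by (rule has_field_derivative_transform_within_open[of _ _ _ "-{1}"])
       (use assms(2) in \<open>auto simp: riemann_zeta_eq_regular\<close>)
  thus ?thesis by (auto dest!: DERIV_imp_deriv simp: power2_eq_square)
qed

lemma has_field_derivative_regular_zeta:
  "(regular_zeta has_field_derivative deriv regular_zeta s) (at s)"
  by (rule holomorphic_derivI[OF holomorphic_regular_zeta]) auto

text \<open>
The product rule applied to both sides of the functional equation.  The derivative \<open>g\<close> of \<open>rGamma\<close> is
kept as a parameter since it is needed both at \<open>1\<close> and at zeros of \<open>rGamma\<close>.
\<close>
lemma functional_equation_deriv:
  assumes g: "(rGamma has_field_derivative g) (at (s + 1))"
    and D: "(regular_zeta has_field_derivative D) (at (1 - s))"
  shows "2 * cos (of_real pi * s / 2) * deriv regular_zeta s - of_real pi * sin (of_real pi * s / 2)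
      * regular_zeta s =
     of_real (2 * pi) powr s *
       ((1 - s) * (g * regular_zeta (1 - s)
         + rGamma (s + 1) * (of_real (ln (2 * pi)) * regular_zeta (1 - s) - D))
        - rGamma (s + 1) * regular_zeta (1 - s))"
proof -
  let ?p = "complex_of_real (2 * pi)"
  have g': "((\<lambda>s. rGamma (s + 1)) has_field_derivative g * 1) (at s)"
    by (rule DERIV_chain2[where f = rGamma and g = "\<lambda>s. s + 1", OF g]) (auto intro!: derivative_eq_intros)
  have D': "((\<lambda>s. regular_zeta (1 - s)) has_field_derivative D * (-1)) (at s)"
    by (rule DERIV_chain2[where f = regular_zeta and g
        = "\<lambda>s. 1 - s", OF D]) (auto intro!: derivative_eq_intros)
  have "((\<lambda>s. ?p powr s) has_field_derivative Ln ?p * ?p powr s) (at s)"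
    by (rule has_field_derivative_powr_right) simp
  hence p': "((\<lambda>s. ?p powr s) has_field_derivative of_real (ln (2 * pi)) * ?p powr s) (at s)"
    by (subst (asm) Ln_of_real) auto
  have c': "((\<lambda>s. cos (of_real pi * s / 2))
      has_field_derivative (- sin (of_real pi * s / 2)) * (of_real pi / 2)) (at s)"
    by (rule DERIV_chain2[OF DERIV_cos]) (auto intro!: derivative_eq_intros)
  have i': "((\<lambda>s. 1 - s) has_field_derivative -1) (at s)" by (auto intro!: derivative_eq_intros)
  have L: "((\<lambda>s. 2 * (cos (of_real pi * s / 2) * regular_zeta s)) has_field_derivative
     2 * ((- sin (of_real pi * s / 2)) * (of_real pi / 2) * regular_zeta s
        + deriv regular_zeta s * cos (of_real pi * s / 2))) (at s)"
    by (intro DERIV_cmult DERIV_mult c' has_field_derivative_regular_zeta)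
  have R: "((\<lambda>s. ((1 - s) * rGamma (s + 1)) * (?p powr s * regular_zeta (1 - s))) has_field_derivative
      ((-1) * rGamma (s + 1) + (g * 1) * (1 - s)) * (?p powr s * regular_zeta (1 - s))
      + ((of_real (ln (2 * pi)) * ?p powr s) * regular_zeta (1 - s) + (D * (-1)) * ?p powr s) * ((1
          - s) * rGamma (s + 1))) (at s)"
    by (intro DERIV_mult i' g' p' D')
  have "(\<lambda>s. 2 * (cos (of_real pi * s / 2) * regular_zeta s)) =
      (\<lambda>s. ((1 - s) * rGamma (s + 1)) * (?p powr s * regular_zeta (1 - s)))"
    using functional_equation by (simp only: mult.assoc)
  from DERIV_unique[OF L R[folded this]] show ?thesis by (simp add: algebra_simps)
qed

lemma riemann_zeta_0: "riemann_zeta 0 = - 1 / 2"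
  by (simp add: riemann_zeta_eq_regular regular_zeta_0)

text \<open>
Euler's constant enters twice with opposite signs, through \<open>rGamma\<close> at \<open>1\<close> and through zeta at \<open>1\<close>,
and cancels.
\<close>
lemma deriv_riemann_zeta_0: "deriv riemann_zeta 0 = - of_real (ln (2 * pi)) / 2"
proof -
  have g: "(rGamma has_field_derivative (euler_mascheroni :: complex)) (at (0 + 1))"
    using has_field_derivative_rGamma_no_nonpos_int[of "1 :: complex"] by simp
  have D: "(regular_zeta has_field_derivative euler_mascheroni) (at (1 - 0))"
    using deriv_regular_zeta_1 by simp
  from functional_equation_deriv[OF g D]
  have "2 * deriv regular_zeta 0 = of_real (ln (2 * pi)) - 1" by simp
  hence "deriv regular_zeta 0 = (of_real (ln (2 * pi)) - 1) / 2" by (simp add: field_simps)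
  with has_field_derivative_regular_zeta[of 0]
  have "(regular_zeta has_field_derivative (of_real (ln (2 * pi)) - 1) / 2) (at 0)" by simp
  from deriv_riemann_zeta_eq[OF this] show ?thesis
    by (simp add: regular_zeta_0 field_simps)
qed

lemma cos_of_nat_pi: "cos (of_real pi * - of_nat (2 * n) / 2) = ((-1) ^ n :: complex)"
proof -
  have "cos (of_real pi * - of_nat (2 * n) / 2) = cos (complex_of_real (pi * real n))"
    by (simp add: mult.commute flip: cos_minus[of "complex_of_real pi * _"])
  also have "\<dots> = of_real (cos (pi * real n))" by (rule cos_of_real)
  also have "\<dots> = (-1) ^ n" by (simp add: cos_npi2)
  finally show ?thesis .
qed

lemma regular_zeta_neg_even:
  assumes "n \<ge> 1"
  shows "regular_zeta (- of_nat (2 * n)) = 0"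
proof -
  have "(- of_nat (2 * n) + 1 :: complex) = - of_nat (2 * n - 1)"
    using assms by (simp add: of_nat_diff)
  moreover have "rGamma (- of_nat (2 * n - 1) :: complex) = 0" by (simp add: rGamma_eq_zero_iff)
  ultimately have "rGamma (- of_nat (2 * n) + 1 :: complex) = 0" by (simp only:)
  with functional_equation[of "- of_nat (2 * n)"] show ?thesis
    unfolding cos_of_nat_pi by simp
qed

lemma riemann_zeta_neg_even: "n \<ge> 1 \<Longrightarrow> riemann_zeta (- of_nat (2 * n)) = 0"
  by (subst riemann_zeta_eq_regular) (auto simp: regular_zeta_neg_even simp del: of_nat_mult dest!:
      arg_cong[of _ _ Re])

text \<open>
At \<open>s = -2n\<close> both \<open>regular_zeta s\<close> and \<open>rGamma (s + 1)\<close> vanish, so in the differentiated functional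
equation only the derivatives of these two functions remain.
\<close>
lemma deriv_riemann_zeta_neg_even:
  assumes n: "n \<ge> 1"
  shows "deriv riemann_zeta (- of_nat (2 * n)) =
    (-1) ^ n * fact (2 * n) / (2 * of_real (2 * pi) ^ (2 * n)) * riemann_zeta (of_nat (2 * n + 1))"
proof -
  define s :: complex where "s = - of_nat (2 * n)"
  define k where "k = 2 * n - 1"
  have k: "2 * n = Suc k" using n by (simp add: k_def)
  have s1: "s + 1 = - of_nat k" by (simp add: s_def k)
  have g: "(rGamma has_field_derivative ((-1) ^ k * fact k)) (at (s + 1))"
    unfolding s1 by (rule has_field_derivative_rGamma_nonpos_int)
  have rg: "rGamma (s + 1) = 0" unfolding s1 by (simp add: rGamma_eq_zero_iff)
  have ok: "(-1 :: complex) ^ k = -1"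
  proof -
    have "odd k" using n by (simp add: k_def)
    thus ?thesis by simp
  qed
  have z0: "regular_zeta s = 0" unfolding s_def by (rule regular_zeta_neg_even[OF n])
  have z1: "regular_zeta (1 - s) = of_nat (2 * n) * riemann_zeta (of_nat (2 * n + 1))"
  proof -
    have e: "1 - s = of_nat (2 * n + 1)" by (simp add: s_def)
    have "(of_nat (2 * n + 1) :: complex) \<noteq> 1" using n by (simp del: of_nat_mult)
    thus ?thesis unfolding e regular_zeta_def by simp
  qed
  have p: "complex_of_real (2 * pi) powr s = 1 / of_real (2 * pi) ^ (2 * n)"
    unfolding s_def by (simp add: powr_minus powr_nat divide_inverse del: of_nat_mult of_real_mult)
  have sne: "s - 1 \<noteq> 0"
  proof
    assume "s - 1 = 0"
    hence "- (of_nat (2 * n + 1) :: complex) = 0" by (simp add: s_def)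
    thus False by (simp only: neg_equal_0_iff_equal of_nat_eq_0_iff)
  qed
  have "2 * (-1) ^ n * deriv regular_zeta s
      = of_real (2 * pi) powr s * ((1 - s) * ((-1) ^ k * fact k * regular_zeta (1 - s)))"
  proof -
    have "cos (of_real pi * s / 2) = (-1) ^ n" unfolding s_def by (rule cos_of_nat_pi)
    thus ?thesis using functional_equation_deriv[OF g has_field_derivative_regular_zeta]
      by (simp add: rg z0)
  qed
  also have "\<dots> = (s - 1) * (fact (2 * n) * riemann_zeta (of_nat (2 * n + 1)) / of_real (2 * pi) ^ (2
      * n))"
  proof -
    have fk: "fact (2 * n) = of_nat (2 * n) * (fact k :: complex)" unfolding k by (rule fact_Suc)
    show ?thesis unfolding ok z1 p fk by (simp add: divide_inverse algebra_simps)
  qed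
  finally have "(-1) ^ n * (2 * (-1) ^ n * deriv regular_zeta s) = (-1) ^ n *
      ((s - 1) * (fact (2 * n) * riemann_zeta (of_nat (2 * n + 1)) / of_real (2 * pi) ^ (2 * n)))" by simp
  also have "(-1) ^ n * (2 * (-1) ^ n * deriv regular_zeta s) = 2 * deriv regular_zeta s"
  proof -
    have "a * (2 * a * d) = 2 * (a * a) * d" for a d :: complex by simp
    moreover have "(-1 :: complex) ^ n * (-1) ^ n = 1" by (simp flip: power_mult_distrib)
    ultimately show ?thesis by (simp only: mult_1_right)
  qed
  finally have D: "deriv regular_zeta s
      = (s - 1) * ((-1) ^ n * fact (2 * n) / (2 * of_real (2 * pi) ^ (2 * n))
          * riemann_zeta (of_nat (2 * n + 1)))"
    by (simp add: field_simps)
  have "deriv riemann_zeta s = (deriv regular_zeta s * (s - 1) - regular_zeta s) / (s - 1)\<^sup>2"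
    by (rule deriv_riemann_zeta_eq[OF has_field_derivative_regular_zeta]) (use sne in auto)
  also have "\<dots> = (-1) ^ n * fact (2 * n) / (2 * of_real (2 * pi) ^ (2 * n))
      * riemann_zeta (of_nat (2 * n + 1))"
    unfolding z0 D using sne by (simp add: power2_eq_square)
  finally show ?thesis unfolding s_def .
qed

section \<open>Evaluation of the derivative series\<close>

lemma has_field_derivative_zeta_term:
  assumes p: "((\<lambda>s. pochhammer s j) has_field_derivative p) (at s)" and s: "s + of_nat j \<noteq> 1"
  shows "(zeta_term y j has_field_derivative
     (p * riemann_zeta (s + of_nat j) + pochhammer s j * deriv riemann_zeta (s + of_nat j)) / fact j
         * of_real y ^ j) (at s)"
proof -
  have "(riemann_zeta has_field_derivative deriv riemann_zeta (s + of_nat j)) (at (s + of_nat j))"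
    using field_differentiable_riemann_zeta[OF s] by (rule field_differentiable_derivI)
  hence z: "((\<lambda>s. riemann_zeta (s + of_nat j))
      has_field_derivative deriv riemann_zeta (s + of_nat j) * 1) (at s)"
    by (rule DERIV_chain2[where f = riemann_zeta and g
        = "\<lambda>s. s + of_nat j"]) (auto intro!: derivative_eq_intros)
  have "((\<lambda>s. (pochhammer s j * riemann_zeta (s + of_nat j)) * (of_real y ^ j
      / fact j)) has_field_derivative
      (p * riemann_zeta (s + of_nat j) + deriv riemann_zeta (s + of_nat j) * 1 * pochhammer s j)
          * (of_real y ^ j / fact j)) (at s)"
    by (intro DERIV_cmult_right DERIV_mult p z)
  also have "(\<lambda>s. (pochhammer s j * riemann_zeta (s + of_nat j)) * (of_real y ^ j / fact j))
      = zeta_term y j"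
    by (simp add: zeta_term_def fun_eq_iff)
  also have "(p * riemann_zeta (s + of_nat j) + deriv riemann_zeta (s + of_nat j) * 1
      * pochhammer s j) * (of_real y ^ j / fact j) =
     (p * riemann_zeta (s + of_nat j) + pochhammer s j * deriv riemann_zeta (s + of_nat j)) / fact j
         * of_real y ^ j"
    by (simp add: mult.commute)
  finally show ?thesis .
qed

text \<open>
The summand containing the derivative of the Pochhammer symbol is multiplied by \<open>\<zeta>(-2n) = 0\<close>.
\<close>
lemma deriv_zeta_term_below:
  assumes N: "N = 2 * i + 2 * n" and n: "n \<ge> 1"
  shows "deriv (zeta_term y (2 * i)) (- of_nat N) =
    fact N * of_real y ^ (2 * i) * ((-1) ^ n * riemann_zeta (of_nat (2 * n + 1))
      / (2 * fact (2 * i) * of_real (2 * pi) ^ (2 * n)))"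
proof -
  have e: "(- of_nat N + of_nat (2 * i) :: complex) = - of_nat (2 * n)" by (simp add: N)
  have ne: "(- of_nat (2 * n) :: complex) \<noteq> 1"
    by (auto simp del: of_nat_mult dest!: arg_cong[of _ _ Re])
  have "((\<lambda>s. pochhammer s (2 * i)) has_field_derivative
     (pochhammer (- of_nat N) (2 * i) * (\<Sum>k<2 * i. 1 / (- of_nat N
         + of_nat k)))) (at (- of_nat N :: complex))"
  proof (rule has_field_derivative_pochhammer)
    fix k assume "k < 2 * i"
    hence "N \<noteq> k" using N n by simp
    thus "- of_nat N + of_nat k \<noteq> (0 :: complex)" by (simp add: add_eq_0_iff)
  qed
  from DERIV_imp_deriv[OF has_field_derivative_zeta_term[OF this]]
  have "deriv (zeta_term y (2 * i)) (- of_nat N) =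
      pochhammer (- of_nat N) (2 * i) / fact (2 * i) * deriv riemann_zeta (- of_nat (2 * n))
          * of_real y ^ (2 * i)"
    using ne by (simp only: e riemann_zeta_neg_even[OF n] not_False_eq_True mult_zero_right
        add_0_left times_divide_eq_left)
  also have "pochhammer (- of_nat N :: complex) (2 * i) / fact (2 * i) = of_nat (N choose (2 * i))"
    unfolding binomial_gbinomial gbinomial_pochhammer by simp
  also have "\<dots> = fact N / (fact (2 * i) * fact (2 * n))"
    by (subst binomial_fact) (simp_all add: N)
  finally show ?thesis unfolding deriv_riemann_zeta_neg_even[OF n] by (simp add: mult_ac)
qed

lemma deriv_zeta_term_middle:
  assumes "even N"
  shows "deriv (zeta_term y N) (- of_nat N) = of_real y ^ N * ((harm N - of_real (ln (2 * pi))) / 2)"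
proof -
  have e: "(- of_nat N + of_nat N :: complex) = 0" by simp
  have "deriv (zeta_term y N) (- of_nat N) =
      (- ((-1) ^ N * fact N * harm N) * riemann_zeta 0 + pochhammer (- of_nat N) N * deriv riemann_zeta 0)
        / fact N * of_real y ^ N"
    using DERIV_imp_deriv[OF has_field_derivative_zeta_term[OF deriv_pochhammer_at_neg[of N], of y]]
    by (simp only: e) simp
  also have "pochhammer (- of_nat N :: complex) N = (-1) ^ N * fact N" by (rule pochhammer_same)
  also have "(-1 :: complex) ^ N = 1" using assms by simp
  also have "- (1 * fact N * harm N) * riemann_zeta 0 + 1 * fact N * deriv riemann_zeta 0 =
      fact N * ((harm N - of_real (ln (2 * pi))) / 2)"
    unfolding riemann_zeta_0 deriv_riemann_zeta_0 by (simp add: field_simps)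
  finally show ?thesis by simp
qed

text \<open>
The summand containing the derivative of zeta is multiplied by a vanishing Pochhammer symbol.
\<close>
lemma deriv_zeta_term_above:
  assumes "even N"
  shows "deriv (zeta_term y (N + 2 * Suc j)) (- of_nat N) =
    fact N * of_real y ^ N * (riemann_zeta (of_nat (2 * Suc j)) / pochhammer (of_nat (2 * Suc j)) (N + 1)
      * of_real y ^ (2 * Suc j))"
proof -
  define r where "r = 2 * j + 1"
  have i: "N + 2 * Suc j = N + Suc r" and r: "2 * Suc j = Suc r" by (simp_all add: r_def)
  have e: "(- of_nat N + of_nat (N + Suc r) :: complex) = of_nat (Suc r)" by simp
  have ne: "(of_nat (Suc r) :: complex) \<noteq> 1" by (simp add: r_def del: of_nat_Suc of_nat_add of_nat_mult)
  have p0: "pochhammer (- of_nat N :: complex) (N + Suc r) = 0"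
    by (simp add: pochhammer_of_nat_eq_0_lemma)
  have "deriv (zeta_term y (N + Suc r)) (- of_nat N) =
     ((-1) ^ N * fact N * fact r) * riemann_zeta (of_nat (Suc r)) / fact (N + Suc r)
         * of_real y ^ (N + Suc r)"
    using DERIV_imp_deriv[OF has_field_derivative_zeta_term[OF deriv_pochhammer_beyond[of N r], of y]] ne
    by (simp only: e p0) simp
  also have "(-1 :: complex) ^ N = 1" using assms by simp
  also have "fact (N + Suc r) = fact r * pochhammer (of_nat (Suc r) :: complex) (N + 1)"
  proof -
    have "fact (r + (N + 1)) = pochhammer (1 :: complex) (r + (N + 1))" by (rule pochhammer_fact)
    also have "\<dots> = pochhammer 1 r * pochhammer (1 + of_nat r) (N + 1)" by (rule pochhammer_product')
    finally show ?thesis by (simp add: pochhammer_fact add_ac)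
  qed
  finally show ?thesis unfolding i r by (simp add: power_add mult_ac)
qed

theorem theorem1p2:
  fixes m :: nat and x :: real
  assumes "m \<ge> 1" and "0 < x" and "x < 2 * pi"
  shows "(\<lambda>j. let k = Suc j in
            riemann_zeta (of_nat (2 * k)) / pochhammer (of_nat (2 * k)) (2 * m - 1)
              * of_real (x / (2 * pi)) ^ (2 * k))
         sums
         ( (of_real (ln x) - harm (2 * m - 2)) / (2 * fact (2 * m - 2))
         + of_real (2 * pi / x) ^ (2 * m - 2) / (2 * fact (2 * m - 2))
             * (hurwitz_zeta' (2 - 2 * of_nat m) (1 - x / (2 * pi))
                + hurwitz_zeta' (2 - 2 * of_nat m) (x / (2 * pi)))
         + (- 1) ^ m * (\<Sum>k<m - 1.
               (- 1) ^ k * of_real x powi (2 * int k - 2 * int m + 2)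
                 * riemann_zeta (2 * of_nat m - 2 * of_nat k - 1) / (2 * fact (2 * k))))"
proof -
  define y where "y = x / (2 * pi)"
  define N where "N = 2 * m - 2"
  \<comment> \<open>The derivatives with \<open>2 * i > N\<close> are \<open>c\<close> times the summands of the theorem.\<close>
  define c :: complex where "c = fact N * of_real y ^ N"
  define h where "h = hurwitz_zeta' (2 - 2 * of_nat m) (1 - y) + hurwitz_zeta' (2 - 2 * of_nat m) y"
  let ?D = "\<lambda>i. deriv (zeta_term y (2 * i)) (- of_nat N)"
  have y: "0 < y" "y < 1" using assms by (auto simp: y_def)
  have N: "even N" by (simp add: N_def)
  have c: "c \<noteq> 0" using y by (simp add: c_def)
  have m: "2 * m = N + 2" using assms(1) by (simp add: N_def)
  have sN: "2 - 2 * of_nat m = (- of_nat N :: complex)"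
  proof -
    have "2 * of_nat m = (of_nat (N + 2) :: complex)" unfolding m[symmetric] by simp
    thus ?thesis by simp
  qed
  have "?D sums ((h + of_real (ln y) * of_real y ^ N) / 2)"
    using hurwitz_zeta'_symmetric_sums[OF y N] unfolding h_def sN .
  hence "(\<lambda>j. ?D (j + m)) sums ((h + of_real (ln y) * of_real y ^ N) / 2 - (\<Sum>i<m. ?D i))"
    by (rule sums_split_initial_segment)
  hence "(\<lambda>j. ?D (j + m) / c) sums (((h + of_real (ln y) * of_real y ^ N) / 2 - (\<Sum>i<m. ?D i)) / c)"
    by (rule sums_divide)
  also have "(\<lambda>j. ?D (j + m) / c) = (\<lambda>j. let k = Suc j in
            riemann_zeta (of_nat (2 * k)) / pochhammer (of_nat (2 * k)) (2 * m - 1)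
              * of_real (x / (2 * pi)) ^ (2 * k))"
  proof
    fix j
    have "2 * (j + m) = N + 2 * Suc j" "2 * m - 1 = N + 1" using m by simp_all
    thus "?D (j + m) / c = (let k = Suc j in
            riemann_zeta (of_nat (2 * k)) / pochhammer (of_nat (2 * k)) (2 * m - 1)
              * of_real (x / (2 * pi)) ^ (2 * k))"
      using deriv_zeta_term_above[OF N, of y j] c
      unfolding Let_def c_def y_def by (simp only:) simp
  qed
  also have "((h + of_real (ln y) * of_real y ^ N) / 2 - (\<Sum>i<m. ?D i)) / c =
     (of_real (ln x) - harm N) / (2 * fact N) + of_real (2 * pi / x) ^ N / (2 * fact N) * h
      + (- 1) ^ m * (\<Sum>k<m - 1. (- 1) ^ k * of_real x powi (2 * int k - 2 * int m + 2)
                 * riemann_zeta (2 * of_nat m - 2 * of_nat k - 1) / (2 * fact (2 * k)))"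
  proof -
    have yN: "(of_real y :: complex) ^ N \<noteq> 0" using y by simp
    have "{..<m} = insert (m - 1) {..<m - 1}" using assms(1) by auto
    hence "(\<Sum>i<m. ?D i) = ?D (m - 1) + (\<Sum>i<m - 1. ?D i)" by simp
    also have "2 * (m - 1) = N" by (simp add: N_def)
    finally have split: "(\<Sum>i<m. ?D i) / c = deriv (zeta_term y N) (- of_nat N) / c + (\<Sum>i<m - 1. ?D i / c)"
      by (simp add: add_divide_distrib sum_divide_distrib)
    have mid: "deriv (zeta_term y N) (- of_nat N) / c = (harm N - of_real (ln (2 * pi))) / (2 * fact N)"
    proof -
      have "Y * (a / 2) / (F * Y) = a / (2 * F)" if "Y \<noteq> 0" for Y a F :: complex
        using that by simp
      from this[OF yN] show ?thesis unfolding deriv_zeta_term_middle[OF N] c_def .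
    qed
    have low: "?D i / c = - ((-1) ^ m * ((- 1) ^ i * of_real x powi (2 * int i - 2 * int m + 2)
                 * riemann_zeta (2 * of_nat m - 2 * of_nat i - 1) / (2 * fact (2 * i))))"
      if i: "i < m - 1" for i
    proof -
      define n where "n = m - 1 - i"
      have n: "n \<ge> 1" and mn: "m = n + i + 1" and Nn: "N = 2 * i + 2 * n"
        using i by (auto simp: n_def N_def)
      have z: "2 * of_nat m - 2 * of_nat i - 1 = (of_nat (2 * n + 1) :: complex)" by (simp add: mn)
      have px: "(of_real x :: complex) powi (2 * int i - 2 * int m + 2) = 1 / of_real x ^ (2 * n)"
      proof -
        have "2 * int i - 2 * int m + 2 = - int (2 * n)" by (simp add: mn)
        thus ?thesis by (simp only: power_int_minus power_int_of_nat inverse_eq_divide)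
      qed
      have "(of_real x :: complex) = of_real y * of_real (2 * pi)"
        unfolding of_real_mult[symmetric] by (simp add: y_def)
      hence xy: "(of_real x :: complex) ^ (2 * n) = of_real y ^ (2 * n) * of_real (2 * pi) ^ (2 * n)"
        by (simp only: power_mult_distrib)
      have cN: "c = fact N * (of_real y ^ (2 * i) * of_real y ^ (2 * n))"
        unfolding c_def Nn power_add ..
      have sg: "(-1 :: complex) ^ m * (-1) ^ i = - ((-1) ^ n)"
      proof -
        have "(-1 :: complex) ^ i * (-1) ^ i = 1" by (simp flip: power_mult_distrib)
        moreover have "(-1 :: complex) ^ m * (-1) ^ i = - ((-1) ^ n * ((-1) ^ i * (-1) ^ i))"
          unfolding mn by (simp add: power_add)
        ultimately show ?thesis by (simp only: mult_1_right)
      qed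
      have "?D i / c = (-1) ^ n * riemann_zeta (of_nat (2 * n + 1))
          / (2 * fact (2 * i) * (of_real y ^ (2 * n) * of_real (2 * pi) ^ (2 * n)))"
        unfolding deriv_zeta_term_below[OF Nn n] cN using y by simp
      also have "\<dots> = - (((-1) ^ m * (-1) ^ i) * (1 / of_real x ^ (2 * n))
                 * riemann_zeta (of_nat (2 * n + 1)) / (2 * fact (2 * i)))"
        unfolding sg xy by simp
      finally show ?thesis unfolding z px
          by (simp only: mult.assoc times_divide_eq_right times_divide_eq_left mult_1_right)
    qed
    define R where "R = (-1 :: complex) ^ m * (\<Sum>i<m - 1. (- 1) ^ i * of_real x powi (2 * int i - 2
        * int m + 2)
                 * riemann_zeta (2 * of_nat m - 2 * of_nat i - 1) / (2 * fact (2 * i)))"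
    have lows: "(\<Sum>i<m - 1. ?D i / c) = - R"
      unfolding R_def sum_distrib_left sum_negf[symmetric] by (rule sum.cong[OF refl], rule low) simp
    have "ln x = ln y + ln (2 * pi)"
      unfolding y_def using assms(2) by (simp add: ln_div)
    hence lnx: "complex_of_real (ln x) = of_real (ln y) + of_real (ln (2 * pi))"
        by (simp only: of_real_add)
    have hc: "of_real (2 * pi / x) ^ N / (2 * fact N) * h = h / 2 / c"
    proof -
      have "2 * pi / x = inverse y" by (simp add: y_def)
      hence "(of_real (2 * pi / x) :: complex) ^ N = inverse (of_real y ^ N)"
        by (simp only: of_real_inverse power_inverse)
      moreover have "inverse Y / (2 * F) * h = h / 2 / (F * Y)" for Y F :: complex
        by (simp add: inverse_eq_divide mult_ac)
      ultimately show ?thesis unfolding c_def by (simp only:)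
    qed
    have lny: "of_real (ln y) * of_real y ^ N / 2 / c = of_real (ln y) / (2 * fact N)"
    proof -
      have "a * Y / 2 / (F * Y) = a / (2 * F)" if "Y \<noteq> 0" for Y a F :: complex
        using that by simp
      from this[OF yN] show ?thesis unfolding c_def .
    qed
    have "((h + of_real (ln y) * of_real y ^ N) / 2 - (\<Sum>i<m. ?D i)) / c =
        h / 2 / c + of_real (ln y) * of_real y ^ N / 2 / c - (\<Sum>i<m. ?D i) / c"
      by (simp only: add_divide_distrib diff_divide_distrib)
    also have "\<dots> = h / 2 / c + of_real (ln y) / (2 * fact N) - ((harm N - of_real (ln (2 * pi)))
        / (2 * fact N) + - R)"
      by (simp only: lny split mid lows)
    also have "\<dots> = (of_real (ln x) - harm N) / (2 * fact N) + h / 2 / c + R"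
      unfolding lnx by (simp only: add_divide_distrib diff_divide_distrib) simp
    finally show ?thesis unfolding hc R_def .
  qed
  finally show ?thesis unfolding h_def y_def N_def .
qed

end
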